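(* Let $xPy$ be a non-valid relational formula of the $(\{\mathbf{1},\cup,\cap\};\_)$-fragment of $\mathsf{RL}(\mathbf{1})$. Then the dual tableau procedure described in the context, started on the initial deduction tree for $xPy$, yields a non-axiomatic not further expandable branch $\theta$ of a dual tableau for $xPy$ and a model $\mathcal{M}_\theta$ that (with the valuation $v_\theta$ returned together with it) falsifies every formula on $\theta$ and, therefore, $xPy$ itself.
   Context: **Syntax and semantics.** Let $\mathbb{RV}$ be a countably infinite set of relational variables $\mathsf{r},\mathsf{s},\dots$, $\mathbf{1}$ a relational constant, $\mathbb{OV}$ a countably infinite set of object variables. A formula is an expression $xRy$ with $x,y\in\mathbb{OV}$ and $R$ a relational term; only terms built from $\mathbb{RV}\cup\{\mathbf{1}\}$ with $-$ (complement), $\cup$, $\cap$, $;$ (composition) are needed here. A Boolean term is one involving only the operators $-,\cup,\cap$. A literal is a formula $x\mathsf{r}y$, $x\mathbf{1}y$, $x(-\mathsf{r})y$ or $x(-\mathbf{1})y$. A $(;)$-formula (resp. $(-;)$-formula) is a formula whose term has the form $(R;S)$ (resp. $-(R;S)$). A model is $\mathcal{M}=(U,m)$ with $U\neq\emptyset$ and $m:\mathbb{RV}\to\wp(U\times U)$, extended to all terms by $m(\mathbf{1})=U\times U$, $m(-R)=(U\times U)\setminus m(R)$, $m(R\cup S)=m(R)\cup m(S)$, $m(R\cap S)=m(R)\cap m(S)$, $m(R;S)=\{(a,b):(a,c)\in m(R)\text{ and }(c,b)\in m(S)\text{ for some }c\in U\}$. A valuation in $\mathcal{M}$ is a function $v:\mathbb{OV}\to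 U$; $\mathcal{M},v\models xRy$ iff $(v(x),v(y))\in m(R)$, and otherwise $\mathcal{M}$ and $v$ falsify $xRy$. A formula is valid if it is satisfied by every model and every valuation in it. Terms are assumed to be simplified, inside-out, by the identities $\mathbf{1}\cup P\equiv P\cup\mathbf{1}\equiv\mathbf{1}$, $(-\mathbf{1})\cup P\equiv P\cup(-\mathbf{1})\equiv P$, $\mathbf{1}\cap P\equiv P\cap\mathbf{1}\equiv P$, $(-\mathbf{1})\cap P\equiv P\cap(-\mathbf{1})\equiv-\mathbf{1}$, $-(-\mathbf{1})\equiv\mathbf{1}$. **The fragment.** It consists of the formulae $xPy$ with $P\in\mathbb{RT}_0$, where $\mathbb{RT}_0$ is the smallest set of terms containing $\mathbf{1}$ and all relational variables and such that, if $P,Q,B,H\in\mathbb{RT}_0$ and $S\in\{H,\mathbf{1}\}$, with $B$ a Boolean term containing neither $\mathbf{1}$ nor $-$, and $H$ containing $\mathbf{1}$ only inside terms of type $(B;\mathbf{1})$ (with left subterm a Boolean term of this kind), then $(-P),(P\cup Q),(P\cap Q),(B;S),(\mathbf{1};S)\in\mathbb{RT}_0$. Below, $B,B_1$ denote Boolean terms without $\mathbf{1}$ and $-$. **Bool-constructions.** The complement normal form $\mathsf{nf}_-$ on Boolean terms: $\mathsf{nf}_-$ fixes $\mathbf{1}$, $-\mathbf{1}$, $\mathsf{s}$, $-\mathsf{s}$ ($\mathsf{s}\in\mathbb{RV}$), commutes with $\cup$ and $\cap$, and $\mathsf{nf}_-(-(S\cap H))=\mathsf{nf}_-(-S)\cup\mathsf{nf}_-(-H)$,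 $\mathsf{nf}_-(-(S\cup H))=\mathsf{nf}_-(-S)\cap\mathsf{nf}_-(-H)$, $\mathsf{nf}_-(--S)=\mathsf{nf}_-(S)$. A term is in complement normal form if complement acts in it only on relational variables or constants. For a set $N$ of formulae and Boolean terms $R,S$: every literal in $N$ is a $\mathsf{Bool}_N$-formula; $x(R\cap S)y$ is a $\mathsf{Bool}_N$-formula if either $xRy$ is a $\mathsf{Bool}_N$-formula and $S$ is in complement normal form, or $xSy$ is a $\mathsf{Bool}_N$-formula and $R$ is in complement normal form; $x(R\cup S)y$ is a $\mathsf{Bool}_N$-formula if both $xRy$ and $xSy$ are. The formula $xRy$ has a Bool-construction from $N$ if $x\,\mathsf{nf}_-(R)\,y$ is a $\mathsf{Bool}_N$-formula. $V(R,x,N)$ is the set of object variables $z$ such that $xRz$ has a Bool-construction from $N$. **Deduction trees.** Nodes are labelled by (and identified with) disjunctive sets of formulae. A set is axiomatic if it contains some $uRw$ together with $u(-R)w$, or some $u\mathbf{1}w$. A branch is a maximal path; $\bigcup\theta$ is the set of all formulae in the nodes of $\theta$ and $W_\theta$ the set of object variables occurring in them. A branch is axiomatic (closed) if one of its nodes is axiomatic; a tree is closed if all its branches are. The initial deduction tree for $xPy$ is the single node $\{xPy\}$. A deduction tree is extended at a non-axiomatic leaf $N$ of a branch $\theta$ by choosing $\varphi\in N$ and a rule applicable to $\varphi$, and appending, for each conclusion set $\Gamma$ (two conclusion sets, separated by $|$, give branching), the node $(N\setminus\{\varphi\})\cup\Gamma$. All literals $u(-\mathbf{1})w$ are assumed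 to be implicitly contained in every node. The rules are: - Boolean rules: $u(R\cup S)w\leadsto uRw,uSw$; $u(-(R\cup S))w\leadsto u(-R)w\,|\,u(-S)w$; $u(R\cap S)w\leadsto uRw\,|\,uSw$; $u(-(R\cap S))w\leadsto u(-R)w,u(-S)w$; $u(--R)w\leadsto uRw$. - $(-;)$-rules, with $z$ a new object variable: $u(-(B;S))y\leadsto u(-B)z,\ z(-S)y$ if $S\neq\mathbf{1}$; $u(-(B;\mathbf{1}))y\leadsto u(-B)z$; $x(-(\mathbf{1};S))y\leadsto z(-S)y$ if $S\neq\mathbf{1}$, applied provided that the current branch contains no formula $z'(-S)y$ for any "new" variable $z'$ (otherwise the formula cannot be decomposed). The formula $x(-(\mathbf{1};\mathbf{1}))y$ is not decomposed. - $(;)_a$: $u(B;S)y\leadsto zSy,\ u(B;S)y$, with $z\in V(-B,u,\bigcup\theta)$. - $(;)_b$: $x(\mathbf{1};S)y\leadsto zSy,\ x(\mathbf{1};S)y$, with $z$ any variable on the current node, provided that the current branch does not already contain $zSy$ (otherwise the formula is not decomposed with $z$). **Order on variables.** A variable $z\in W_\theta\setminus\{x,y\}$ is a descendant of degree 1 of $w$ if it was generated by decomposing a formula $w(-(B;S))y$ of $\theta$; descendants of degree $n$ are obtained by iterating $n$ times. $<_\theta$ is a total order on $W_\theta$ such that: $x<_\theta w$ for every $w\in W_\theta\setminus\{x\}$; $x_1<_\theta x_2$ for $x_1,x_2\in W_\theta\setminus\{x,y\}$ with $x_1$ introduced in $\theta$ before $x_2$; $y<_\theta z$ for every descendant $z$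 of $y$; $w<_\theta y$ for every $w$ (other than $y$) that is not a descendant of $y$. **Blocking.** For two $(-;)$-formulae occurring in a branch $\theta$, $z'(-(B;S))y$ blocks $z(-(B;S))y$ if: the two are identical except for the left object variable; $z'(-(B;S))y$ has already been decomposed in $\theta$, using the object variable $w$; and for every $(;)$-formula $z(B_1;Q)y$ occurring in $\theta$ such that $z(-B_1)w$ has a Bool-construction from the set of literals that result from the Boolean decomposition of $z(-B)w$, the formula $z'(B_1;Q)y$ occurs in $\theta$ as well. **Procedure.** Start with the initial deduction tree for $xPy$; the set $\mathit{Lit}_{(-;)}$ is empty at the beginning. 1. For every non-axiomatic branch $\theta$ of the current deduction tree: 2. While $\theta$ is non-axiomatic and is further expandable, let $z$ be the smallest variable w.r.t. $<_\theta$ such that formulae on $\theta$ with left variable $z$ have not been decomposed in $\theta$. Apply to the formulae on $\theta$ having left variable $z$ the decomposition rules in the following order: Boolean rules, $(-;)$-rules, rule $(;)_a$; then apply rule $(;)_b$ to decompose the $(;)$-formulae of type $x(\mathbf{1};S)y$ in $\theta$ with the variable $z$, till saturation. It is required that: (a) all the rules can be applied at most once with the same premise; (b) a formula $z(-(B;S))y$ is not decomposed if it is blocked by a formula $z'(-(B;S))y$ occurring in $\theta$; in that case, if $z'(-(B;S))y$ was decomposed in $\theta$ with the variable $w$, then for every literal $z'(-\mathsf{r})w\in\bigcup\theta$ (obtained by applying the Boolean rules to $z'(-B)w$) the literal $z(-\mathsf{r})w$ is stored in $\mathit{Lit}_{(-;)}$. 3. If $\theta$ is axiomatic and all the other branches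 of the current deduction tree are axiomatic, then the current deduction tree is a (closed) proof tree for $xPy$ and the procedure terminates. If $\theta$ is axiomatic and there are still non-axiomatic branches, return to step 1. 4. Otherwise $\theta$ is a non-axiomatic not further expandable branch. Construct $\mathcal{M}_\theta=(U_\theta,m_\theta)$ as follows: $U_\theta=W_\theta$; let $\mathit{Lit}_\theta$ be the set of all literals occurring in $\theta$; the interpretation $m_\theta$ is defined by putting $(x',y')\notin m_\theta(R)$ if and only if $x'Ry'\in\mathit{Lit}_\theta\cup\mathit{Lit}_{(-;)}$. Let $v_\theta:\mathbb{OV}\to U_\theta$ be a valuation such that $v_\theta(u)=u$ for every $u\in U_\theta$. Terminate returning $\theta$, $\mathcal{M}_\theta$ and $v_\theta$.
   Formalization: The condition defining m_θ is imposed only for R = −r (for R = r the model for x(r;s)y satisfies it); Lit_(-;) is read off the returned branch, for formulae still blocked there, not accumulated globally; the last condition on <_θ is imposed only if x ≠ y. *)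

theory Defs
  imports Main
begin

section \<open>Relational terms, formulae, and their semantics\<close>

type_synonym rv = nat
type_synonym ov = nat

datatype rterm =
    RVar rv
  | ROne
  | RCompl rterm
  | RUnion rterm rterm
  | RInter rterm rterm
  | RComp rterm rterm

text \<open>The triple \<open>(x, R, y)\<close> is the formula \<open>xRy\<close>.\<close>

type_synonym fm = "ov \<times> rterm \<times> ov"

type_synonym 'u model = "'u set \<times> (rv \<Rightarrow> ('u \<times> 'u) set)"

definition is_model :: "'u model \<Rightarrow> bool" where
  "is_model M \<longleftrightarrow> fst M \<noteq> {} \<and> (\<forall>r. snd M r \<subseteq> fst M \<times> fst M)"

primrec interp :: "'u model \<Rightarrow> rterm \<Rightarrow> ('u \<times> 'u) set" where
  "interp M (RVar r) = snd M r"
| "interp M ROne = fst M \<times> fst M"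
| "interp M (RCompl R) = fst M \<times> fst M - interp M R"
| "interp M (RUnion R S) = interp M R \<union> interp M S"
| "interp M (RInter R S) = interp M R \<inter> interp M S"
| "interp M (RComp R S) = interp M R O interp M S"

definition is_valuation :: "'u model \<Rightarrow> (ov \<Rightarrow> 'u) \<Rightarrow> bool" where
  "is_valuation M v \<longleftrightarrow> range v \<subseteq> fst M"

fun satisfies :: "'u model \<Rightarrow> (ov \<Rightarrow> 'u) \<Rightarrow> fm \<Rightarrow> bool" where
  "satisfies M v (x, R, y) \<longleftrightarrow> (v x, v y) \<in> interp M R"

text \<open>Validity refers to the models whose universe is a set of elements of the type \<open>'u\<close>.
  A theorem that assumes \<open>\<not> valid TYPE('u) \<phi>\<close> for a type variable \<open>'u\<close> covers every formula
  that is falsified by some model whatsoever.\<close>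

definition valid :: "'u itself \<Rightarrow> fm \<Rightarrow> bool" where
  "valid _ \<phi> \<longleftrightarrow>
    (\<forall>(M :: 'u model) v. is_model M \<longrightarrow> is_valuation M v \<longrightarrow> satisfies M v \<phi>)"


section \<open>Simplified terms\<close>

fun simp_compl :: "rterm \<Rightarrow> rterm" where
  "simp_compl R = (if R = RCompl ROne then ROne else RCompl R)"

fun simp_union :: "rterm \<Rightarrow> rterm \<Rightarrow> rterm" where
  "simp_union R S =
    (if R = ROne \<or> S = ROne then ROne
     else if R = RCompl ROne then S
     else if S = RCompl ROne then R
     else RUnion R S)"

fun simp_inter :: "rterm \<Rightarrow> rterm \<Rightarrow> rterm" where
  "simp_inter R S =
    (if R = RCompl ROne \<or> S = RCompl ROne then RCompl ROne
     else if R = ROne then S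
     else if S = ROne then R
     else RInter R S)"

primrec simplify :: "rterm \<Rightarrow> rterm" where
  "simplify (RVar r) = RVar r"
| "simplify ROne = ROne"
| "simplify (RCompl R) = simp_compl (simplify R)"
| "simplify (RUnion R S) = simp_union (simplify R) (simplify S)"
| "simplify (RInter R S) = simp_inter (simplify R) (simplify S)"
| "simplify (RComp R S) = RComp (simplify R) (simplify S)"

definition simplified :: "rterm \<Rightarrow> bool" where
  "simplified R \<longleftrightarrow> simplify R = R"


section \<open>The fragment\<close>

primrec bool_term :: "rterm \<Rightarrow> bool" where
  "bool_term (RVar r) \<longleftrightarrow> True"
| "bool_term ROne \<longleftrightarrow> True"
| "bool_term (RCompl R) \<longleftrightarrow> bool_term R"
| "bool_term (RUnion R S) \<longleftrightarrow> bool_term R \<and> bool_term S"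
| "bool_term (RInter R S) \<longleftrightarrow> bool_term R \<and> bool_term S"
| "bool_term (RComp R S) \<longleftrightarrow> False"

primrec pos_bool_term :: "rterm \<Rightarrow> bool" where
  "pos_bool_term (RVar r) \<longleftrightarrow> True"
| "pos_bool_term ROne \<longleftrightarrow> False"
| "pos_bool_term (RCompl R) \<longleftrightarrow> False"
| "pos_bool_term (RUnion R S) \<longleftrightarrow> pos_bool_term R \<and> pos_bool_term S"
| "pos_bool_term (RInter R S) \<longleftrightarrow> pos_bool_term R \<and> pos_bool_term S"
| "pos_bool_term (RComp R S) \<longleftrightarrow> False"

text \<open>Every occurrence of \<open>1\<close> lies inside a subterm \<open>(B;1)\<close> with \<open>pos_bool_term B\<close>.\<close>

primrec guarded_ones :: "rterm \<Rightarrow> bool" where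
  "guarded_ones (RVar r) \<longleftrightarrow> True"
| "guarded_ones ROne \<longleftrightarrow> False"
| "guarded_ones (RCompl R) \<longleftrightarrow> guarded_ones R"
| "guarded_ones (RUnion R S) \<longleftrightarrow> guarded_ones R \<and> guarded_ones S"
| "guarded_ones (RInter R S) \<longleftrightarrow> guarded_ones R \<and> guarded_ones S"
| "guarded_ones (RComp R S) \<longleftrightarrow>
     (pos_bool_term R \<and> S = ROne) \<or> (guarded_ones R \<and> guarded_ones S)"

inductive_set RT0 :: "rterm set" where
  one: "ROne \<in> RT0"
| var: "RVar r \<in> RT0"
| compl: "P \<in> RT0 \<Longrightarrow> RCompl P \<in> RT0"
| union: "P \<in> RT0 \<Longrightarrow> Q \<in> RT0 \<Longrightarrow> RUnion P Q \<in> RT0"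
| inter: "P \<in> RT0 \<Longrightarrow> Q \<in> RT0 \<Longrightarrow> RInter P Q \<in> RT0"
| comp: "B \<in> RT0 \<Longrightarrow> pos_bool_term B \<Longrightarrow> H \<in> RT0 \<Longrightarrow> guarded_ones H \<Longrightarrow> S \<in> {H, ROne}
    \<Longrightarrow> RComp B S \<in> RT0"
| one_comp: "H \<in> RT0 \<Longrightarrow> guarded_ones H \<Longrightarrow> S \<in> {H, ROne} \<Longrightarrow> RComp ROne S \<in> RT0"


section \<open>Bool-constructions\<close>

fun literal :: "fm \<Rightarrow> bool" where
  "literal (x, RVar r, y) \<longleftrightarrow> True"
| "literal (x, ROne, y) \<longleftrightarrow> True"
| "literal (x, RCompl (RVar r), y) \<longleftrightarrow> True"
| "literal (x, RCompl ROne, y) \<longleftrightarrow> True"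
| "literal (x, _, y) \<longleftrightarrow> False"

text \<open>The clauses for compositions are irrelevant: the normal form is only used on Boolean
  terms.\<close>

fun compl_nf :: "rterm \<Rightarrow> rterm" where
  "compl_nf (RVar r) = RVar r"
| "compl_nf ROne = ROne"
| "compl_nf (RUnion R S) = RUnion (compl_nf R) (compl_nf S)"
| "compl_nf (RInter R S) = RInter (compl_nf R) (compl_nf S)"
| "compl_nf (RComp R S) = RComp R S"
| "compl_nf (RCompl (RVar r)) = RCompl (RVar r)"
| "compl_nf (RCompl ROne) = RCompl ROne"
| "compl_nf (RCompl (RInter R S)) = RUnion (compl_nf (RCompl R)) (compl_nf (RCompl S))"
| "compl_nf (RCompl (RUnion R S)) = RInter (compl_nf (RCompl R)) (compl_nf (RCompl S))"
| "compl_nf (RCompl (RCompl R)) = compl_nf R"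
| "compl_nf (RCompl (RComp R S)) = RCompl (RComp R S)"

primrec in_compl_nf :: "rterm \<Rightarrow> bool" where
  "in_compl_nf (RVar r) \<longleftrightarrow> True"
| "in_compl_nf ROne \<longleftrightarrow> True"
| "in_compl_nf (RCompl R) \<longleftrightarrow> R = ROne \<or> (\<exists>r. R = RVar r)"
| "in_compl_nf (RUnion R S) \<longleftrightarrow> in_compl_nf R \<and> in_compl_nf S"
| "in_compl_nf (RInter R S) \<longleftrightarrow> in_compl_nf R \<and> in_compl_nf S"
| "in_compl_nf (RComp R S) \<longleftrightarrow> in_compl_nf R \<and> in_compl_nf S"

inductive bool_fm :: "fm set \<Rightarrow> fm \<Rightarrow> bool" for N where
  lit: "\<phi> \<in> N \<Longrightarrow> literal \<phi> \<Longrightarrow> bool_fm N \<phi>"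
| inter1: "bool_term R \<Longrightarrow> bool_term S \<Longrightarrow> bool_fm N (x, R, y) \<Longrightarrow> in_compl_nf S
    \<Longrightarrow> bool_fm N (x, RInter R S, y)"
| inter2: "bool_term R \<Longrightarrow> bool_term S \<Longrightarrow> bool_fm N (x, S, y) \<Longrightarrow> in_compl_nf R
    \<Longrightarrow> bool_fm N (x, RInter R S, y)"
| union: "bool_term R \<Longrightarrow> bool_term S \<Longrightarrow> bool_fm N (x, R, y) \<Longrightarrow> bool_fm N (x, S, y)
    \<Longrightarrow> bool_fm N (x, RUnion R S, y)"

fun bool_construction :: "fm set \<Rightarrow> fm \<Rightarrow> bool" where
  "bool_construction N (x, R, y) \<longleftrightarrow> bool_term R \<and> bool_fm N (x, compl_nf R, y)"

definition V :: "rterm \<Rightarrow> ov \<Rightarrow> fm set \<Rightarrow> ov set" where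
  "V R x N = {z. bool_construction N (x, R, z)}"


section \<open>Deduction trees\<close>

text \<open>A rule application consists of the rule, its premise and, except for the Boolean rules,
  the object variable \<open>z\<close> it is applied with.\<close>

datatype rule_app =
    Boolean fm
  | NegComp fm ov
  | CompA fm ov
  | CompB fm ov

primrec premise :: "rule_app \<Rightarrow> fm" where
  "premise (Boolean \<phi>) = \<phi>"
| "premise (NegComp \<phi> z) = \<phi>"
| "premise (CompA \<phi> z) = \<phi>"
| "premise (CompB \<phi> z) = \<phi>"

text \<open>The list of conclusion sets; it is empty if the premise does not have the shape required
  by the rule. In a deduction tree for \<open>xPy\<close> with \<open>P \<in> RT0\<close>, formulae \<open>u(1;S)w\<close> and \<open>u(-(1;S))w\<close>
  occur only with \<open>u = x\<close> and \<open>w = y\<close>, and formulae \<open>u(B;S)w\<close> and \<open>u(-(B;S))w\<close> only with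
  \<open>w = y\<close>, so the rules need not mention \<open>x\<close> and \<open>y\<close>.\<close>

fun conclusions :: "rule_app \<Rightarrow> fm set list" where
  "conclusions (Boolean (u, RUnion R S, w)) = [{(u, R, w), (u, S, w)}]"
| "conclusions (Boolean (u, RCompl (RUnion R S), w)) = [{(u, RCompl R, w)}, {(u, RCompl S, w)}]"
| "conclusions (Boolean (u, RInter R S, w)) = [{(u, R, w)}, {(u, S, w)}]"
| "conclusions (Boolean (u, RCompl (RInter R S), w)) = [{(u, RCompl R, w), (u, RCompl S, w)}]"
| "conclusions (Boolean (u, RCompl (RCompl R), w)) = [{(u, R, w)}]"
| "conclusions (NegComp (u, RCompl (RComp B S), y) z) =
    (if B = ROne
     then (if S = ROne then [] else [{(z, RCompl S, y)}])
     else (if S = ROne then [{(u, RCompl B, z)}] else [{(u, RCompl B, z), (z, RCompl S, y)}]))"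
| "conclusions (CompA (u, RComp B S, y) z) =
    (if B = ROne then [] else [{(z, S, y), (u, RComp B S, y)}])"
| "conclusions (CompB (u, RComp B S, y) z) =
    (if B = ROne then [{(z, S, y), (u, RComp B S, y)}] else [])"
| "conclusions _ = []"

text \<open>An inner node carries the rule application by which it has been extended.\<close>

datatype dtree =
    Leaf "fm set"
  | Inner "fm set" rule_app "dtree list"

text \<open>A branch consists of its inner nodes, from the root downwards, with the rule applications
  performed at them, and of its leaf.\<close>

type_synonym branch = "(fm set \<times> rule_app) list \<times> fm set"

fun branches :: "dtree \<Rightarrow> branch set" where
  "branches (Leaf N) = {([], N)}"
| "branches (Inner N a ts) = (\<Union>t\<in>set ts. (\<lambda>(h, L). ((N, a) # h, L)) ` branches t)"

definition leaf :: "branch \<Rightarrow> fm set" where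
  "leaf \<theta> = snd \<theta>"

definition apps :: "branch \<Rightarrow> rule_app list" where
  "apps \<theta> = map snd (fst \<theta>)"

definition nodes :: "branch \<Rightarrow> fm set list" where
  "nodes \<theta> = map fst (fst \<theta>) @ [snd \<theta>]"

definition fms :: "branch \<Rightarrow> fm set" where
  "fms \<theta> = \<Union> (set (nodes \<theta>))"

definition vars :: "fm set \<Rightarrow> ov set" where
  "vars N = (\<Union>(u, R, w)\<in>N. {u, w})"

definition W :: "branch \<Rightarrow> ov set" where
  "W \<theta> = vars (fms \<theta>)"

text \<open>The literals \<open>u(-1)w\<close>, implicitly contained in every node, matter only here: no
  \<open>B\<close> in a Bool-construction involves \<open>1\<close>, and every model falsifies these literals.\<close>

definition axiomatic :: "fm set \<Rightarrow> bool" where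
  "axiomatic N \<longleftrightarrow>
    (let N' = N \<union> {(u, RCompl ROne, w) | u w. True}
     in (\<exists>u R w. (u, R, w) \<in> N' \<and> (u, RCompl R, w) \<in> N') \<or> (\<exists>u w. (u, ROne, w) \<in> N'))"

definition axiomatic_branch :: "branch \<Rightarrow> bool" where
  "axiomatic_branch \<theta> \<longleftrightarrow> (\<exists>N\<in>set (nodes \<theta>). axiomatic N)"

definition introduced :: "branch \<Rightarrow> ov list" where
  "introduced \<theta> = concat (map (\<lambda>a. case a of NegComp \<phi> z \<Rightarrow> [z] | _ \<Rightarrow> []) (apps \<theta>))"

fun side_condition :: "branch \<Rightarrow> rule_app \<Rightarrow> bool" where
  "side_condition \<theta> (Boolean \<phi>) \<longleftrightarrow> True"
| "side_condition \<theta> (NegComp (u, RCompl (RComp B S), y) z) \<longleftrightarrow>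
    z \<notin> W \<theta> \<and> (B = ROne \<longrightarrow> \<not> (\<exists>z'\<in>set (introduced \<theta>). (z', RCompl S, y) \<in> fms \<theta>))"
| "side_condition \<theta> (CompA (u, RComp B S, y) z) \<longleftrightarrow> z \<in> V (RCompl B) u (fms \<theta>)"
| "side_condition \<theta> (CompB (u, RComp B S, y) z) \<longleftrightarrow> z \<in> vars (leaf \<theta>) \<and> (z, S, y) \<notin> fms \<theta>"
| "side_condition \<theta> _ \<longleftrightarrow> False"

definition applicable :: "branch \<Rightarrow> rule_app \<Rightarrow> bool" where
  "applicable \<theta> a \<longleftrightarrow> premise a \<in> leaf \<theta> \<and> conclusions a \<noteq> [] \<and> side_condition \<theta> a"

text \<open>\<open>extend t \<theta> a t'\<close>: the tree \<open>t'\<close> results from \<open>t\<close> by performing \<open>a\<close> at the leaf of the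
  branch \<open>\<theta>\<close> of \<open>t\<close>.\<close>

definition successors :: "fm set \<Rightarrow> rule_app \<Rightarrow> fm set list" where
  "successors N a = map (\<lambda>\<Gamma>. (N - {premise a}) \<union> \<Gamma>) (conclusions a)"

inductive extend :: "dtree \<Rightarrow> branch \<Rightarrow> rule_app \<Rightarrow> dtree \<Rightarrow> bool" where
  here: "extend (Leaf N) ([], N) a (Inner N a (map Leaf (successors N a)))"
| below: "extend t (h, L) a t'
    \<Longrightarrow> extend (Inner N b (ts @ t # us)) ((N, b) # h, L) a (Inner N b (ts @ t' # us))"

inductive deduction_tree :: "fm \<Rightarrow> dtree \<Rightarrow> bool" for \<phi> where
  initial: "deduction_tree \<phi> (Leaf {\<phi>})"
| step: "deduction_tree \<phi> t \<Longrightarrow> \<not> axiomatic (leaf \<theta>) \<Longrightarrow> applicable \<theta> a \<Longrightarrow> extend t \<theta> a t'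
    \<Longrightarrow> deduction_tree \<phi> t'"


section \<open>Order on variables\<close>

definition child :: "branch \<Rightarrow> ov \<Rightarrow> ov \<Rightarrow> bool" where
  "child \<theta> w z \<longleftrightarrow> (\<exists>B S y. B \<noteq> ROne \<and> NegComp (w, RCompl (RComp B S), y) z \<in> set (apps \<theta>))"

definition descendant :: "branch \<Rightarrow> ov \<Rightarrow> ov \<Rightarrow> bool" where
  "descendant \<theta> = (child \<theta>)\<^sup>+\<^sup>+"

definition introduced_before :: "branch \<Rightarrow> ov \<Rightarrow> ov \<Rightarrow> bool" where
  "introduced_before \<theta> u w \<longleftrightarrow>
    (\<exists>i j. i < j \<and> j < length (introduced \<theta>) \<and> introduced \<theta> ! i = u \<and> introduced \<theta> ! j = w)"

text \<open>The last condition presupposes \<open>x \<noteq> y\<close>; for \<open>x = y\<close> it would contradict the first one.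
  The conditions determine the order of any two elements of \<open>W \<theta>\<close>, so quantifying over all
  variable orders in \<open>smallest\<close> amounts to referring to the only one.\<close>

definition variable_order :: "ov \<Rightarrow> ov \<Rightarrow> branch \<Rightarrow> (ov \<times> ov) set \<Rightarrow> bool" where
  "variable_order x y \<theta> r \<longleftrightarrow>
    strict_linear_order_on (W \<theta>) r \<and>
    (\<forall>w\<in>W \<theta> - {x}. (x, w) \<in> r) \<and>
    (\<forall>x1\<in>W \<theta> - {x, y}. \<forall>x2\<in>W \<theta> - {x, y}. introduced_before \<theta> x1 x2 \<longrightarrow> (x1, x2) \<in> r) \<and>
    (\<forall>z\<in>W \<theta>. descendant \<theta> y z \<longrightarrow> (y, z) \<in> r) \<and>
    (x \<noteq> y \<longrightarrow> (\<forall>w\<in>W \<theta> - {y}. \<not> descendant \<theta> y w \<longrightarrow> (w, y) \<in> r))"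

definition smallest :: "ov \<Rightarrow> ov \<Rightarrow> branch \<Rightarrow> ov set \<Rightarrow> ov \<Rightarrow> bool" where
  "smallest x y \<theta> Z z \<longleftrightarrow>
    z \<in> Z \<and> (\<forall>r. variable_order x y \<theta> r \<longrightarrow> (\<forall>w\<in>Z - {z}. (z, w) \<in> r))"


section \<open>Blocking\<close>

definition decomposed_with :: "branch \<Rightarrow> fm \<Rightarrow> ov \<Rightarrow> bool" where
  "decomposed_with \<theta> \<phi> w \<longleftrightarrow> NegComp \<phi> w \<in> set (apps \<theta>)"

text \<open>\<open>blocks \<theta> B S y z' w z\<close>: the formula \<open>z'(-(B;S))y\<close>, decomposed in \<open>\<theta>\<close> using \<open>w\<close>, blocks
  \<open>z(-(B;S))y\<close>. The literals resulting from the Boolean decomposition of \<open>z(-B)w\<close> are taken to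
  be the copies of those that the decomposition of \<open>z'(-B)w\<close> has left on \<open>\<theta>\<close>.\<close>

definition blocks :: "branch \<Rightarrow> rterm \<Rightarrow> rterm \<Rightarrow> ov \<Rightarrow> ov \<Rightarrow> ov \<Rightarrow> ov \<Rightarrow> bool" where
  "blocks \<theta> B S y z' w z \<longleftrightarrow>
    B \<noteq> ROne \<and> z' \<noteq> z \<and>
    (z', RCompl (RComp B S), y) \<in> fms \<theta> \<and>
    (z, RCompl (RComp B S), y) \<in> fms \<theta> \<and>
    decomposed_with \<theta> (z', RCompl (RComp B S), y) w \<and>
    (\<forall>B1 Q. (z, RComp B1 Q, y) \<in> fms \<theta> \<longrightarrow>
      bool_construction {(z, RCompl (RVar r), w) | r. (z', RCompl (RVar r), w) \<in> fms \<theta>}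
        (z, RCompl B1, w) \<longrightarrow>
      (z', RComp B1 Q, y) \<in> fms \<theta>)"

text \<open>Literals recorded for the formulae of \<open>\<theta>\<close> that are left undecomposed because they are
  blocked. Blocking is relative to the branch and may lapse while the branch grows, so these
  literals are read off the branch itself instead of being accumulated in a global set.\<close>

definition blocked_lits :: "branch \<Rightarrow> fm set" where
  "blocked_lits \<theta> =
    {(z, RCompl (RVar r), w) | z r w. \<exists>B S y z'.
       blocks \<theta> B S y z' w z \<and>
       \<not> (\<exists>w'. decomposed_with \<theta> (z, RCompl (RComp B S), y) w') \<and>
       (z', RCompl (RVar r), w) \<in> fms \<theta>}"


section \<open>The procedure\<close>

fun already_applied :: "branch \<Rightarrow> rule_app \<Rightarrow> bool" where
  "already_applied \<theta> (NegComp \<phi> z) \<longleftrightarrow> (\<exists>w. decomposed_with \<theta> \<phi> w)"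
| "already_applied \<theta> a \<longleftrightarrow> a \<in> set (apps \<theta>)"

fun blocked :: "branch \<Rightarrow> rule_app \<Rightarrow> bool" where
  "blocked \<theta> (NegComp (z, RCompl (RComp B S), y) _) \<longleftrightarrow> (\<exists>z' w. blocks \<theta> B S y z' w z)"
| "blocked \<theta> _ \<longleftrightarrow> False"

definition permitted :: "branch \<Rightarrow> rule_app \<Rightarrow> bool" where
  "permitted \<theta> a \<longleftrightarrow> applicable \<theta> a \<and> \<not> already_applied \<theta> a \<and> \<not> blocked \<theta> a"

definition expandable :: "branch \<Rightarrow> bool" where
  "expandable \<theta> \<longleftrightarrow> (\<exists>a. permitted \<theta> a)"

text \<open>The variable in whose turn a rule application is performed: the left variable of the
  premise, but the instantiating variable in the case of \<open>(;)\<^sub>b\<close>.\<close>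

fun app_var :: "rule_app \<Rightarrow> ov" where
  "app_var (Boolean (u, R, w)) = u"
| "app_var (NegComp (u, R, w) z) = u"
| "app_var (CompA (u, R, w) z) = u"
| "app_var (CompB (u, R, w) z) = z"

primrec phase :: "rule_app \<Rightarrow> nat" where
  "phase (Boolean \<phi>) = 0"
| "phase (NegComp \<phi> z) = 1"
| "phase (CompA \<phi> z) = 2"
| "phase (CompB \<phi> z) = 3"

definition pending :: "branch \<Rightarrow> ov set" where
  "pending \<theta> = app_var ` {a. permitted \<theta> a}"

definition branch_lits :: "branch \<Rightarrow> fm set" where
  "branch_lits \<theta> = {\<phi> \<in> fms \<theta>. literal \<phi>}"

text \<open>The condition that \<open>(a, b) \<notin> m(R)\<close> iff \<open>aRb\<close> is one of the literals is imposed for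
  \<open>R = -r\<close>, the form of all the recorded literals. Imposed for \<open>R = r\<close>, it would relate variables
  for which the branch does not provide any literal, and the model for the saturated branch
  \<open>{x(r;s)y}\<close> would satisfy \<open>x(r;s)y\<close>.\<close>

definition branch_model :: "branch \<Rightarrow> ov model" where
  "branch_model \<theta> =
    (W \<theta>, \<lambda>r. {(a, b) \<in> W \<theta> \<times> W \<theta>. (a, RCompl (RVar r), b) \<in> branch_lits \<theta> \<union> blocked_lits \<theta>})"

datatype state =
    Choose dtree
  | Loop dtree branch
  | Decompose dtree branch ov
  | Closed dtree
  | Returned dtree branch "ov model" "ov \<Rightarrow> ov"

inductive proc_step :: "ov \<Rightarrow> ov \<Rightarrow> state \<Rightarrow> state \<Rightarrow> bool" for x y where
  choose: "\<theta> \<in> branches t \<Longrightarrow> \<not> axiomatic_branch \<theta>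
    \<Longrightarrow> proc_step x y (Choose t) (Loop t \<theta>)"
| next_var: "\<not> axiomatic_branch \<theta> \<Longrightarrow> expandable \<theta> \<Longrightarrow> smallest x y \<theta> (pending \<theta>) z
    \<Longrightarrow> proc_step x y (Loop t \<theta>) (Decompose t \<theta> z)"
| apply_rule: "\<not> axiomatic_branch \<theta> \<Longrightarrow> permitted \<theta> a \<Longrightarrow> app_var a = z
    \<Longrightarrow> \<forall>b. permitted \<theta> b \<and> app_var b = z \<longrightarrow> phase a \<le> phase b
    \<Longrightarrow> extend t \<theta> a t' \<Longrightarrow> N' \<in> set (successors (leaf \<theta>) a)
    \<Longrightarrow> proc_step x y (Decompose t \<theta> z) (Decompose t' (fst \<theta> @ [(leaf \<theta>, a)], N') z)"
| saturated: "axiomatic_branch \<theta> \<or> z \<notin> pending \<theta>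
    \<Longrightarrow> proc_step x y (Decompose t \<theta> z) (Loop t \<theta>)"
| branch_closed: "axiomatic_branch \<theta>
    \<Longrightarrow> proc_step x y (Loop t \<theta>) (Choose t)"
| tree_closed: "\<forall>\<theta>\<in>branches t. axiomatic_branch \<theta>
    \<Longrightarrow> proc_step x y (Choose t) (Closed t)"
| return: "\<not> axiomatic_branch \<theta> \<Longrightarrow> \<not> expandable \<theta>
    \<Longrightarrow> is_valuation (branch_model \<theta>) v \<Longrightarrow> \<forall>u\<in>W \<theta>. v u = u
    \<Longrightarrow> proc_step x y (Loop t \<theta>) (Returned t \<theta> (branch_model \<theta>) v)"

definition start :: "fm \<Rightarrow> state" where
  "start \<phi> = Choose (Leaf {\<phi>})"

definition terminal :: "ov \<Rightarrow> ov \<Rightarrow> state \<Rightarrow> bool" where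
  "terminal x y s \<longleftrightarrow> \<not> (\<exists>s'. proc_step x y s s')"

end

theory Submission
  imports Defs "HOL-Library.Multiset"
begin

text \<open>Soundness: a model falsifying all formulae of a branch falsifies, after an update of the
  valuation at the new variable, all formulae of one of its extensions, so the tree of a non-valid
  formula never closes.

  Termination: every formula is decomposed at most once and only finitely many terms occur, so an
  infinite branch would introduce infinitely many variables, and hence decompose formulae
  \<open>z(-(B;S))y\<close> with the same \<open>B\<close> and \<open>S\<close> for infinitely many \<open>z\<close>. By the pigeonhole principle
  infinitely many of these \<open>z\<close> are on the left of the same terms in the limit; once one of them has
  received all of these terms, it blocks the later ones. The multiset ordering lifts this from
  branches to trees.

  Completeness: induction on the size of terms. A literal recorded for a blocked \<open>z(-(B;S))y\<close>
  relates \<open>z\<close> to a variable \<open>w\<close> generated by the blocking formula \<open>z'(-(B;S))y\<close> alone. If the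
  literals relate \<open>z\<close> to \<open>w\<close> by \<open>B1\<close>, for a formula \<open>z(B1;Q)y\<close> of the branch, the blocking
  condition yields \<open>z'(B1;Q)y\<close>, and its decomposition with \<open>w\<close> puts \<open>wQy\<close> on the branch.\<close>


section \<open>Semantics\<close>

lemma interp_subset:
  assumes "is_model M"
  shows "interp M R \<subseteq> fst M \<times> fst M"
  using assms by (induction R) (auto simp: is_model_def)

lemma interp_compl_nf:
  assumes "is_model M"
  shows "interp M (compl_nf R) = interp M R"
proof -
  \<comment> \<open>Needed for double complements: complementation is an involution only on subsets
    of the full relation.\<close>
  have "fst M \<times> fst M - (fst M \<times> fst M - interp M R) = interp M R" for R
    using interp_subset[OF assms, of R] by blast
  then show ?thesis
    by (induction R rule: compl_nf.induct) auto
qed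

text \<open>Nodes are disjunctive sets, so a countermodel of a node has to refute all of its
  formulae at once.\<close>

definition falsifies :: "'u model \<Rightarrow> (ov \<Rightarrow> 'u) \<Rightarrow> fm set \<Rightarrow> bool" where
  "falsifies M v N \<longleftrightarrow> is_valuation M v \<and> (\<forall>\<phi>\<in>N. \<not> satisfies M v \<phi>)"

text \<open>The implicit literals \<open>u(-1)w\<close> fail under every valuation, so adding them
  is harmless; but \<open>u1w\<close> always holds, and so does one of \<open>uRw\<close> and
  \<open>u(-R)w\<close>.\<close>

lemma falsifies_not_axiomatic:
  assumes "falsifies M v N"
  shows "\<not> axiomatic N"
proof -
  let ?N = "N \<union> {(u, RCompl ROne, w) | u w. True}"
  have "v u \<in> fst M" for u
    using assms by (auto simp: falsifies_def is_valuation_def)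
  then have f: "(v u, v w) \<notin> interp M R" if "(u, R, w) \<in> ?N" for u R w
    using that assms by (auto simp: falsifies_def)
  have "(v u, v w) \<in> interp M R \<or> (v u, v w) \<in> interp M (RCompl R)"
    "(v u, v w) \<in> interp M ROne" for u R w
    using \<open>\<And>u. v u \<in> fst M\<close> by auto
  then show ?thesis
    unfolding axiomatic_def Let_def using f by blast
qed

lemma bool_fm_falsified:
  assumes "bool_fm N \<phi>" "falsifies M v N"
  shows "\<not> satisfies M v \<phi>"
  using assms by (induction) (auto simp: falsifies_def)

text \<open>Soundness of the side condition of \<open>CompA\<close>: a Bool-construction from
  refuted literals yields a refuted formula, and the normal form does not change the meaning of
  \<open>-B\<close>.\<close>

lemma V_compl_imp_interp:
  assumes "is_model M" "falsifies M v N" "z \<in> V (RCompl B) u N"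
  shows "(v u, v z) \<in> interp M B"
proof -
  have "bool_fm N (u, compl_nf (RCompl B), z)"
    using assms(3) by (simp add: V_def)
  then have "\<not> satisfies M v (u, compl_nf (RCompl B), z)"
    using assms(2) bool_fm_falsified by blast
  then have "(v u, v z) \<notin> interp M (RCompl B)"
    using interp_compl_nf[OF assms(1), of "RCompl B"] by simp
  then show ?thesis
    using assms(2) by (auto simp: falsifies_def is_valuation_def)
qed

lemma satisfies_upd:
  assumes "\<phi> \<in> N" "z \<notin> vars N"
  shows "satisfies M (v(z := c)) \<phi> = satisfies M v \<phi>"
  using assms by (cases \<phi>) (force simp: vars_def)


section \<open>Growing a branch\<close>

text \<open>The extension made by \<open>apply_rule\<close>, as a function of the conclusion set
  alone, so that it can be iterated without referring to a tree.\<close>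

definition grow :: "branch \<Rightarrow> rule_app \<Rightarrow> fm set \<Rightarrow> branch" where
  "grow \<theta> a \<Gamma> = (fst \<theta> @ [(leaf \<theta>, a)], leaf \<theta> - {premise a} \<union> \<Gamma>)"

lemma leaf_subset_fms: "leaf \<theta> \<subseteq> fms \<theta>"
  by (auto simp: leaf_def fms_def nodes_def)

lemma leaf_grow: "leaf (grow \<theta> a \<Gamma>) = leaf \<theta> - {premise a} \<union> \<Gamma>"
  by (simp add: grow_def leaf_def)

lemma fms_grow: "fms (grow \<theta> a \<Gamma>) = fms \<theta> \<union> \<Gamma>"
  by (auto simp: grow_def fms_def nodes_def leaf_def)

lemma apps_grow: "apps (grow \<theta> a \<Gamma>) = apps \<theta> @ [a]"
  by (simp add: grow_def apps_def)

lemma vars_Un: "vars (M \<union> N) = vars M \<union> vars N"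
  by (auto simp: vars_def)

lemma W_grow: "W (grow \<theta> a \<Gamma>) = W \<theta> \<union> vars \<Gamma>"
  by (simp add: W_def fms_grow vars_Un)

lemma set_introduced: "set (introduced \<theta>) = {z. \<exists>\<phi>. NegComp \<phi> z \<in> set (apps \<theta>)}"
  by (force simp: introduced_def split: rule_app.splits)

lemma mem_vars: "(u, R, w) \<in> N \<Longrightarrow> u \<in> vars N \<and> w \<in> vars N"
  by (force simp: vars_def)

text \<open>Inversion of the rules. The two conclusion sets of a branching rule are merged into one
  case by \<open>Q \<in> {R, S}\<close>.\<close>

lemma conclusions_cases [consumes 1]:
  assumes "\<Gamma> \<in> set (conclusions a)"
  obtains
    (union) u R S w where "a = Boolean (u, RUnion R S, w)" "\<Gamma> = {(u, R, w), (u, S, w)}"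
  | (compl_union) u R S w Q where "a = Boolean (u, RCompl (RUnion R S), w)"
      "Q \<in> {R, S}" "\<Gamma> = {(u, RCompl Q, w)}"
  | (inter) u R S w Q where "a = Boolean (u, RInter R S, w)" "Q \<in> {R, S}" "\<Gamma> = {(u, Q, w)}"
  | (compl_inter) u R S w where "a = Boolean (u, RCompl (RInter R S), w)"
      "\<Gamma> = {(u, RCompl R, w), (u, RCompl S, w)}"
  | (compl_compl) u R w where "a = Boolean (u, RCompl (RCompl R), w)" "\<Gamma> = {(u, R, w)}"
  | (neg_one) u S w z where "a = NegComp (u, RCompl (RComp ROne S), w) z" "S \<noteq> ROne"
      "\<Gamma> = {(z, RCompl S, w)}"
  | (neg_comp) u B S w z where "a = NegComp (u, RCompl (RComp B S), w) z" "B \<noteq> ROne"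
      "\<Gamma> = insert (u, RCompl B, z) (if S = ROne then {} else {(z, RCompl S, w)})"
  | (comp_a) u B S w z where "a = CompA (u, RComp B S, w) z" "B \<noteq> ROne"
      "\<Gamma> = {(z, S, w), (u, RComp B S, w)}"
  | (comp_b) u S w z where "a = CompB (u, RComp ROne S, w) z"
      "\<Gamma> = {(z, S, w), (u, RComp ROne S, w)}"
  using assms by (cases a rule: conclusions.cases) (auto split: if_splits)

text \<open>All formulae of the branch, not just those of its leaf, are kept refuted, since
  \<open>V\<close> draws its literals from the whole branch. Only the \<open>(-;)\<close>-rules
  change the valuation: the new variable is mapped to the intermediate point of the
  composition.\<close>

lemma falsifies_grow:
  assumes "is_model M" and fals: "falsifies M v (fms \<theta>)" and app: "applicable \<theta> a"
  shows "\<exists>\<Gamma>\<in>set (conclusions a). \<exists>v'. falsifies M v' (fms (grow \<theta> a \<Gamma>))"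
proof -
  have val: "v u \<in> fst M" for u
    using fals by (auto simp: falsifies_def is_valuation_def)
  have prem: "premise a \<in> fms \<theta>"
    using app leaf_subset_fms[of \<theta>] by (auto simp: applicable_def)
  then have "\<not> satisfies M v (premise a)"
    using fals by (simp add: falsifies_def)
  note prem = prem this
  have keep: ?thesis if "\<Gamma> \<in> set (conclusions a)" "\<forall>\<phi>\<in>\<Gamma>. \<not> satisfies M v \<phi>" for \<Gamma>
    using that fals by (auto simp: fms_grow falsifies_def)
  \<comment> \<open>This set only reveals the shape of \<open>a\<close>; for branching rules the
    refuted conclusion set is chosen afresh.\<close>
  obtain \<Gamma> where "\<Gamma> \<in> set (conclusions a)"
    using app by (cases "conclusions a") (auto simp: applicable_def)
  then show ?thesis
  proof (cases rule: conclusions_cases)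
    case (union u R S w)
    then show ?thesis using keep prem by auto
  next
    case (compl_union u R S w Q)
    then show ?thesis
      using keep[of "{(u, RCompl R, w)}"] keep[of "{(u, RCompl S, w)}"] prem val by auto
  next
    case (inter u R S w Q)
    then show ?thesis
      using keep[of "{(u, R, w)}"] keep[of "{(u, S, w)}"] prem by auto
  next
    case (compl_inter u R S w)
    then show ?thesis using keep prem val by auto
  next
    case (compl_compl u R w)
    then show ?thesis using keep prem val by auto
  next
    case (neg_one u S w z)
    then have "(v u, v w) \<in> interp M (RComp ROne S)"
      using prem val by auto
    then obtain c where c: "c \<in> fst M" "(c, v w) \<in> interp M S"
      by auto
    have z: "z \<notin> vars (fms \<theta>)"
      using app neg_one by (simp add: applicable_def W_def)
    then have "w \<noteq> z"
      using prem(1) neg_one(1) by (auto dest: mem_vars)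
    then have "falsifies M (v(z := c)) (fms (grow \<theta> a {(z, RCompl S, w)}))"
      using fals c z by (auto simp: fms_grow falsifies_def satisfies_upd is_valuation_def)
    then show ?thesis using neg_one by auto
  next
    case (neg_comp u B S w z)
    then have "(v u, v w) \<in> interp M (RComp B S)"
      using prem val by auto
    then obtain c where c: "(v u, c) \<in> interp M B" "(c, v w) \<in> interp M S"
      by auto
    then have cM: "c \<in> fst M"
      using interp_subset[OF assms(1)] by blast
    have z: "z \<notin> vars (fms \<theta>)"
      using app neg_comp by (simp add: applicable_def W_def)
    then have "u \<noteq> z" "w \<noteq> z"
      using prem(1) neg_comp(1) by (auto dest: mem_vars)
    then have "falsifies M (v(z := c)) (fms (grow \<theta> a \<Gamma>))"
      using fals c cM z neg_comp(3)
      by (auto simp: fms_grow falsifies_def satisfies_upd is_valuation_def)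
    then show ?thesis using \<open>\<Gamma> \<in> set (conclusions a)\<close> by auto
  next
    case (comp_a u B S w z)
    then have "(v u, v z) \<in> interp M B"
      using app by (intro V_compl_imp_interp[OF assms(1) fals]) (simp add: applicable_def)
    then have "\<not> satisfies M v (z, S, w)"
      using prem comp_a by auto
    then show ?thesis using keep prem comp_a by auto
  next
    case (comp_b u S w z)
    then have "\<not> satisfies M v (z, S, w)"
      using prem val by auto
    then show ?thesis using keep prem comp_b by auto
  qed
qed


section \<open>Terms on a branch\<close>

primrec subterms :: "rterm \<Rightarrow> rterm set" where
  "subterms (RVar r) = {RVar r}"
| "subterms ROne = {ROne}"
| "subterms (RCompl R) = insert (RCompl R) (subterms R)"
| "subterms (RUnion R S) = insert (RUnion R S) (subterms R \<union> subterms S)"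
| "subterms (RInter R S) = insert (RInter R S) (subterms R \<union> subterms S)"
| "subterms (RComp R S) = insert (RComp R S) (subterms R \<union> subterms S)"

lemma finite_subterms: "finite (subterms R)"
  by (induction R) auto

lemma subterms_refl: "R \<in> subterms R"
  by (cases R) auto

lemma subterms_trans: "R \<in> subterms S \<Longrightarrow> subterms R \<subseteq> subterms S"
  by (induction S) auto

text \<open>A finite set closed under the rules, in the manner of a Fischer-Ladner closure: the
  rules pass to subterms and put at most one new complement in front of them.\<close>

definition closure_terms :: "rterm \<Rightarrow> rterm set" where
  "closure_terms P = subterms P \<union> RCompl ` subterms P"

lemma finite_closure_terms: "finite (closure_terms P)"
  by (simp add: closure_terms_def finite_subterms)

lemma RCompl_closure_terms: "RCompl R \<in> closure_terms P \<longleftrightarrow> R \<in> subterms P"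
  using subterms_trans[of "RCompl R" P] subterms_refl[of R] by (auto simp: closure_terms_def)

lemma subterms_args:
  "RCompl R \<in> subterms P \<Longrightarrow> R \<in> subterms P"
  "RUnion R S \<in> subterms P \<Longrightarrow> R \<in> subterms P \<and> S \<in> subterms P"
  "RInter R S \<in> subterms P \<Longrightarrow> R \<in> subterms P \<and> S \<in> subterms P"
  "RComp R S \<in> subterms P \<Longrightarrow> R \<in> subterms P \<and> S \<in> subterms P"
  by (auto dest!: subterms_trans simp: subterms_refl dest: subsetD[OF _ subterms_refl])

lemma closure_terms_subterms:
  "RUnion R S \<in> closure_terms P \<longleftrightarrow> RUnion R S \<in> subterms P"
  "RInter R S \<in> closure_terms P \<longleftrightarrow> RInter R S \<in> subterms P"
  "RComp R S \<in> closure_terms P \<longleftrightarrow> RComp R S \<in> subterms P"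
  "R \<in> subterms P \<Longrightarrow> R \<in> closure_terms P"
  by (auto simp: closure_terms_def)

lemma closure_terms_conclusions:
  assumes "\<Gamma> \<in> set (conclusions a)" "fst (snd (premise a)) \<in> closure_terms P" "\<phi> \<in> \<Gamma>"
  shows "fst (snd \<phi>) \<in> closure_terms P"
  using assms
  by (cases rule: conclusions_cases)
    (auto simp: RCompl_closure_terms closure_terms_subterms split: if_splits dest: subterms_args)

text \<open>The terms of formulae with an arbitrary left variable, and those of the formulae \<open>xRy\<close>
  that stem from the initial formula by Boolean decomposition.\<close>

primrec inner_term :: "rterm \<Rightarrow> bool" where
  "inner_term (RVar r) \<longleftrightarrow> True"
| "inner_term ROne \<longleftrightarrow> False"
| "inner_term (RCompl R) \<longleftrightarrow> inner_term R"
| "inner_term (RUnion R S) \<longleftrightarrow> inner_term R \<and> inner_term S"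
| "inner_term (RInter R S) \<longleftrightarrow> inner_term R \<and> inner_term S"
| "inner_term (RComp R S) \<longleftrightarrow> pos_bool_term R \<and> (S = ROne \<or> inner_term S)"

primrec outer_term :: "rterm \<Rightarrow> bool" where
  "outer_term (RVar r) \<longleftrightarrow> True"
| "outer_term ROne \<longleftrightarrow> True"
| "outer_term (RCompl R) \<longleftrightarrow> outer_term R"
| "outer_term (RUnion R S) \<longleftrightarrow> outer_term R \<and> outer_term S"
| "outer_term (RInter R S) \<longleftrightarrow> outer_term R \<and> outer_term S"
| "outer_term (RComp R S) \<longleftrightarrow> (R = ROne \<or> pos_bool_term R) \<and> (S = ROne \<or> inner_term S)"

text \<open>The conjunct on \<open>guarded_ones\<close> strengthens the induction: it supplies
  \<open>inner_term H\<close> for the right factor of a composition.\<close>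

lemma RT0_terms:
  assumes "P \<in> RT0"
  shows "outer_term P \<and> (guarded_ones P \<longrightarrow> inner_term P)"
  using assms by induction auto

text \<open>The invariant shape of formulae on a branch for \<open>xPy\<close>. A right variable
  other than \<open>y\<close> stems from a conclusion \<open>u(-B)z\<close> of a
  \<open>(-;)\<close>-rule; the term \<open>1\<close> arises at any left variable when
  \<open>u(B;1)y\<close> is instantiated.\<close>

fun fragment_fm :: "ov \<Rightarrow> ov \<Rightarrow> fm \<Rightarrow> bool" where
  "fragment_fm x y (u, R, w) \<longleftrightarrow>
    (if w = y then inner_term R \<or> R = ROne \<or> (u = x \<and> outer_term R)
     else (\<exists>B. pos_bool_term B \<and> R = RCompl B))"

lemma fragment_fm_conclusions:
  assumes "\<Gamma> \<in> set (conclusions a)" "fragment_fm x y (premise a)" "\<phi> \<in> \<Gamma>"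
    and "\<And>\<psi> z. a = NegComp \<psi> z \<Longrightarrow> z \<noteq> y"
  shows "fragment_fm x y \<phi>"
  using assms by (cases rule: conclusions_cases) (auto split: if_splits)


section \<open>The branches constructed by the procedure\<close>

text \<open>Over-approximates the branches of the procedure: permitted rules may be applied in any
  order.\<close>

inductive proc_branch :: "ov \<Rightarrow> rterm \<Rightarrow> ov \<Rightarrow> branch \<Rightarrow> bool" for x P y where
  initial: "proc_branch x P y ([], {(x, P, y)})"
| grow: "proc_branch x P y \<theta> \<Longrightarrow> permitted \<theta> a \<Longrightarrow> \<Gamma> \<in> set (conclusions a)
    \<Longrightarrow> proc_branch x P y (grow \<theta> a \<Gamma>)"

lemma permitted_premise: "permitted \<theta> a \<Longrightarrow> premise a \<in> leaf \<theta> \<and> premise a \<in> fms \<theta>"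
  using leaf_subset_fms[of \<theta>] by (auto simp: permitted_def applicable_def)

lemma permitted_NegComp:
  assumes "permitted \<theta> (NegComp \<phi> z)"
  shows "z \<notin> W \<theta> \<and> (\<exists>u B S w. \<phi> = (u, RCompl (RComp B S), w))"
  using assms
  by (cases "(\<theta>, NegComp \<phi> z)" rule: side_condition.cases) (auto simp: permitted_def applicable_def)

lemma root_mem:
  assumes "proc_branch x P y \<theta>"
  shows "(x, P, y) \<in> fms \<theta>"
  using assms
proof induction
  case initial
  then show ?case by (simp add: fms_def nodes_def)
qed (simp add: fms_grow)

lemma root_vars:
  assumes "proc_branch x P y \<theta>"
  shows "x \<in> W \<theta>" "y \<in> W \<theta>"
  using mem_vars[OF root_mem[OF assms]] by (auto simp: W_def)

lemma fms_closure_terms: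
  assumes "proc_branch x P y \<theta>" "\<phi> \<in> fms \<theta>"
  shows "fst (snd \<phi>) \<in> closure_terms P"
  using assms
proof (induction arbitrary: \<phi>)
  case initial
  then show ?case
    by (auto simp: fms_def nodes_def closure_terms_def subterms_refl)
next
  case (grow \<theta> a \<Gamma>)
  have "premise a \<in> fms \<theta>"
    using permitted_premise grow.hyps by blast
  from closure_terms_conclusions[OF grow.hyps(3) grow.IH[OF this]] show ?case
    using grow.IH grow.prems unfolding fms_grow by blast
qed

lemma fms_fragment:
  assumes "proc_branch x P y \<theta>" "outer_term P" "\<phi> \<in> fms \<theta>"
  shows "fragment_fm x y \<phi>"
  using assms
proof (induction arbitrary: \<phi>)
  case initial
  then show ?case
    by (auto simp: fms_def nodes_def)
next
  case (grow \<theta> a \<Gamma>)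
  have new: "z \<noteq> y" if "a = NegComp \<psi> z" for \<psi> z
    using permitted_NegComp grow.hyps root_vars that by blast
  have "premise a \<in> fms \<theta>"
    using permitted_premise grow.hyps by blast
  from fragment_fm_conclusions[OF grow.hyps(3) grow.IH[OF grow.prems(1) this]] show ?case
    using grow.IH grow.prems new unfolding fms_grow by blast
qed

text \<open>\<open>fms\<close> collects all nodes, so the conclusion set once chosen stays in
  it.\<close>

lemma apps_conclusions:
  assumes "proc_branch x P y \<theta>" "b \<in> set (apps \<theta>)"
  shows "\<exists>\<Gamma>\<in>set (conclusions b). \<Gamma> \<subseteq> fms \<theta>"
  using assms
proof (induction arbitrary: b)
  case initial
  then show ?case by (simp add: apps_def)
next
  case (grow \<theta> a \<Gamma>)
  show ?case
  proof (cases "b = a")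
    case True
    then show ?thesis using grow.hyps by (auto simp: fms_grow)
  next
    case False
    then have "b \<in> set (apps \<theta>)"
      using grow.prems by (simp add: apps_grow)
    from grow.IH[OF this] show ?thesis
      unfolding fms_grow by blast
  qed
qed

text \<open>\<open>CompA\<close> and \<open>CompB\<close> repeat their premise among the
  conclusions, so only Boolean and \<open>(-;)\<close>-rules remove a formula from the leaf.\<close>

lemma mem_leaf_or_decomposed:
  assumes "proc_branch x P y \<theta>" "\<phi> \<in> fms \<theta>"
  shows "\<phi> \<in> leaf \<theta> \<or> Boolean \<phi> \<in> set (apps \<theta>) \<or> (\<exists>z. NegComp \<phi> z \<in> set (apps \<theta>))"
  using assms
proof (induction arbitrary: \<phi>)
  case initial
  then show ?case by (simp add: fms_def nodes_def leaf_def)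
next
  case (grow \<theta> a \<Gamma>)
  have "premise a \<in> \<Gamma> \<or> Boolean (premise a) = a \<or> (\<exists>z. NegComp (premise a) z = a)"
    using \<open>\<Gamma> \<in> set (conclusions a)\<close> by (cases rule: conclusions_cases) auto
  then show ?case
    using grow.IH[of \<phi>] grow.prems by (auto simp: fms_grow apps_grow leaf_grow)
qed

text \<open>Every conclusion set of a \<open>(-;)\<close>-rule mentions the new variable, which is
  chosen outside \<open>W \<theta>\<close>, where \<open>y\<close> already lies.\<close>

lemma introduced_var:
  assumes "proc_branch x P y \<theta>" "NegComp \<phi> w \<in> set (apps \<theta>)"
  shows "w \<in> W \<theta>" "w \<noteq> y"
proof -
  have "w \<in> W \<theta> \<and> w \<noteq> y"
    using assms
  proof (induction arbitrary: \<phi> w)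
    case initial
    then show ?case by (simp add: apps_def)
  next
    case (grow \<theta> a \<Gamma>)
    show ?case
    proof (cases "NegComp \<phi> w \<in> set (apps \<theta>)")
      case True
      then show ?thesis using grow by (auto simp: W_grow)
    next
      case False
      then have a: "a = NegComp \<phi> w"
        using grow by (auto simp: apps_grow)
      have "w \<in> vars \<Gamma>"
        using \<open>\<Gamma> \<in> set (conclusions a)\<close> a
        by (cases rule: conclusions_cases) (auto simp: vars_def)
      moreover have "w \<notin> W \<theta>"
        using permitted_NegComp grow a by blast
      ultimately show ?thesis
        using root_vars[OF grow.hyps(1)] by (auto simp: W_grow)
    qed
  qed
  then show "w \<in> W \<theta>" "w \<noteq> y" by auto
qed

lemma introduced_unique:
  assumes "proc_branch x P y \<theta>" "NegComp \<phi> w \<in> set (apps \<theta>)" "NegComp \<psi> w \<in> set (apps \<theta>)"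
  shows "\<phi> = \<psi>"
  using assms
proof (induction arbitrary: \<phi> \<psi> w)
  case initial
  then show ?case by (simp add: apps_def)
next
  case (grow \<theta> a \<Gamma>)
  have new: "NegComp \<chi> w \<notin> set (apps \<theta>)" if "a = NegComp \<chi>' w" for \<chi> \<chi>'
    using permitted_NegComp introduced_var(1) grow.hyps that by blast
  show ?case
    using grow.prems grow.IH[of \<phi> w \<psi>] new unfolding apps_grow
    by (metis Un_iff empty_iff insert_iff list.set(1,2) rule_app.inject(2) set_append)
qed

lemma bool_fm_mem:
  assumes "bool_fm N (u, R, w)"
  shows "\<exists>Q. (u, Q, w) \<in> N"
  using assms by (induction "(u, R, w)" arbitrary: R) auto

lemma V_subset_vars: "V R u N \<subseteq> vars N"
  by (auto simp: V_def dest!: bool_fm_mem mem_vars)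

text \<open>\<open>CompA\<close> and \<open>CompB\<close> instantiate with variables of the branch,
  since \<open>V\<close> only offers right variables of formulae present; so the
  \<open>(-;)\<close>-rules are the only source of variables.\<close>

lemma W_subset:
  assumes "proc_branch x P y \<theta>"
  shows "W \<theta> \<subseteq> {x, y} \<union> set (introduced \<theta>)"
  using assms
proof induction
  case initial
  then show ?case by (simp add: W_def fms_def nodes_def vars_def)
next
  case (grow \<theta> a \<Gamma>)
  have leaf: "vars (leaf \<theta>) \<subseteq> W \<theta>"
    using leaf_subset_fms[of \<theta>] by (auto simp: W_def vars_def)
  have V: "V R u (fms \<theta>) \<subseteq> W \<theta>" for R u
    unfolding W_def by (rule V_subset_vars)
  have prem: "vars {premise a} \<subseteq> W \<theta>"
    using permitted_premise[OF grow(2)] by (auto simp: W_def vars_def)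
  have side: "side_condition \<theta> a"
    using grow(2) by (simp add: permitted_def applicable_def)
  have intro: "set (introduced (grow \<theta> a \<Gamma>)) =
      set (introduced \<theta>) \<union> {z. \<exists>\<phi>. a = NegComp \<phi> z}"
    by (auto simp: set_introduced apps_grow)
  have "vars \<Gamma> \<subseteq> W \<theta> \<union> {z. \<exists>\<phi>. a = NegComp \<phi> z}"
    using grow(3)
  proof (cases rule: conclusions_cases)
    case (comp_a u B S w z)
    then show ?thesis using prem side V[of "RCompl B" u] by (auto simp: vars_def)
  next
    case (comp_b u S w z)
    then show ?thesis using prem side leaf by (auto simp: vars_def)
  qed (use prem in \<open>auto simp: vars_def split: if_splits\<close>)
  then show ?case
    using grow.IH unfolding W_grow intro by blast
qed

text \<open>A formula with right variable other than \<open>y\<close> has a term \<open>-B\<close>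
  with positive \<open>B\<close>; only Boolean rules apply to it, and these keep both variables.
  Tracing it back leads to the \<open>(-;)\<close>-rule that created \<open>w\<close>.\<close>

lemma right_var_introduced:
  assumes "proc_branch x P y \<theta>" "outer_term P" "(u, R, w) \<in> fms \<theta>" "w \<noteq> y"
  shows "\<exists>B S v. NegComp (u, RCompl (RComp B S), v) w \<in> set (apps \<theta>)"
  using assms
proof (induction arbitrary: u R w)
  case initial
  then show ?case by (simp add: fms_def nodes_def)
next
  case (grow \<theta> a \<Gamma>)
  have prem: "premise a \<in> fms \<theta>"
    using permitted_premise grow.hyps by blast
  have frag: "fragment_fm x y (premise a)"
    using fms_fragment[OF grow.hyps(1) grow.prems(1) prem] .
  have "(\<exists>R. (u, R, w) \<in> fms \<theta>) \<or> (\<exists>B S v. a = NegComp (u, RCompl (RComp B S), v) w)"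
    if "(u, R, w) \<in> \<Gamma>"
    using grow.hyps(3) frag prem that \<open>w \<noteq> y\<close>
    by (cases rule: conclusions_cases) (auto split: if_splits)
  then have "(\<exists>R. (u, R, w) \<in> fms \<theta>)
      \<or> (\<exists>B S v. a = NegComp (u, RCompl (RComp B S), v) w)"
    using grow.prems(2) unfolding fms_grow by blast
  then have "\<exists>B S v. NegComp (u, RCompl (RComp B S), v) w \<in> set (apps \<theta>) \<or>
      a = NegComp (u, RCompl (RComp B S), v) w"
    using grow.IH[OF grow.prems(1) _ \<open>w \<noteq> y\<close>] by blast
  then show ?case
    by (auto simp: apps_grow)
qed


section \<open>The model of a saturated branch\<close>

lemma finite_fms:
  assumes "proc_branch x P y \<theta>"
  shows "finite (fms \<theta>)"
  using assms
proof induction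
  case initial
  then show ?case by (simp add: fms_def nodes_def)
next
  case (grow \<theta> a \<Gamma>)
  have "finite \<Gamma>"
    using grow.hyps(3) by (cases rule: conclusions_cases) auto
  with grow.IH show ?case by (simp add: fms_grow)
qed

lemma finite_W:
  assumes "proc_branch x P y \<theta>"
  shows "finite (W \<theta>)"
  using finite_fms[OF assms] by (auto simp: W_def vars_def)

lemma fresh_var:
  assumes "proc_branch x P y \<theta>"
  shows "\<exists>z. z \<notin> W \<theta>"
  using finite_W[OF assms] ex_new_if_finite infinite_UNIV_nat by blast

text \<open>A Bool-construction of \<open>-B\<close> for a positive \<open>B\<close> only depends on which variables \<open>r\<close>
  relate the two elements, so it can be carried over to other object variables.\<close>

lemma pos_interp_bool_fm:
  assumes "pos_bool_term B" "(a, b) \<in> interp M B"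
    and "\<And>r. (a, b) \<in> snd M r \<Longrightarrow> (u, RCompl (RVar r), w) \<in> N"
  shows "bool_fm N (u, compl_nf (RCompl B), w)"
proof -
  \<comment> \<open>The normal form of \<open>-B\<close> turns unions into intersections, and
    \<open>inter1\<close> and \<open>inter2\<close> ask this of the factor that is not
    constructed.\<close>
  have nf: "bool_term (compl_nf (RCompl B)) \<and> in_compl_nf (compl_nf (RCompl B))"
    if "pos_bool_term B" for B
    using that by (induction B) auto
  show ?thesis
    using assms(1,2)
    by (induction B) (auto intro: bool_fm.intros simp: assms(3) nf)
qed

lemma pos_bool_term_bool_term: "pos_bool_term B \<Longrightarrow> bool_term B"
  by (induction B) auto

lemma pos_interp_V:
  assumes "pos_bool_term B" "(a, b) \<in> interp M B"
    and "\<And>r. (a, b) \<in> snd M r \<Longrightarrow> (u, RCompl (RVar r), w) \<in> N"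
  shows "bool_construction N (u, RCompl B, w)" "w \<in> V (RCompl B) u N"
  using pos_interp_bool_fm[OF assms] pos_bool_term_bool_term[OF assms(1)] by (auto simp: V_def)

locale saturated_branch =
  fixes x y :: ov and P :: rterm and \<theta> :: branch
  assumes branch: "proc_branch x P y \<theta>"
    and outer: "outer_term P"
    and open_branch: "\<not> axiomatic_branch \<theta>"
    and saturated: "\<not> expandable \<theta>"
begin

section \<open>Closure of a saturated branch under the rules\<close>

lemma not_permitted: "\<not> permitted \<theta> a"
  using saturated by (auto simp: expandable_def)

lemma leaf_not_axiomatic: "\<not> axiomatic (leaf \<theta>)"
  using open_branch by (auto simp: axiomatic_branch_def nodes_def leaf_def)

lemma fragment: "(u, R, w) \<in> fms \<theta> \<Longrightarrow> fragment_fm x y (u, R, w)"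
  using fms_fragment[OF branch outer] .

text \<open>Axiomatic sets are single nodes; formulae from different nodes can clash only once they
  are known to persist down to the leaf.\<close>

lemma undecomposable_in_leaf:
  assumes "\<phi> \<in> fms \<theta>" "conclusions (Boolean \<phi>) = []" "\<And>z. conclusions (NegComp \<phi> z) = []"
  shows "\<phi> \<in> leaf \<theta>"
  using mem_leaf_or_decomposed[OF branch assms(1)] apps_conclusions[OF branch] assms(2,3)
  by fastforce

text \<open>A formula remaining in the leaf would permit its Boolean rule unless that rule had been
  applied before.\<close>

lemma boolean_decomposed:
  assumes "\<phi> \<in> fms \<theta>" "conclusions (Boolean \<phi>) \<noteq> []"
  shows "\<exists>\<Gamma>\<in>set (conclusions (Boolean \<phi>)). \<Gamma> \<subseteq> fms \<theta>"
proof -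
  have "conclusions (NegComp \<phi> z) = []" for z
    using assms(2) by (cases "Boolean \<phi>" rule: conclusions.cases) auto
  then have "NegComp \<phi> z \<notin> set (apps \<theta>)" for z
    using apps_conclusions[OF branch] by fastforce
  then have "Boolean \<phi> \<in> set (apps \<theta>)"
    using mem_leaf_or_decomposed[OF branch assms(1)] not_permitted[of "Boolean \<phi>"] assms(2)
    by (auto simp: permitted_def applicable_def)
  then show ?thesis
    using apps_conclusions[OF branch] by blast
qed

lemma no_one: "(u, ROne, w) \<notin> fms \<theta>"
proof
  assume "(u, ROne, w) \<in> fms \<theta>"
  then have "(u, ROne, w) \<in> leaf \<theta>"
    by (rule undecomposable_in_leaf) auto
  then show False
    using leaf_not_axiomatic by (auto simp: axiomatic_def)
qed

lemma no_complementary: "\<not> ((u, RVar r, w) \<in> fms \<theta> \<and> (u, RCompl (RVar r), w) \<in> fms \<theta>)"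
proof
  assume "(u, RVar r, w) \<in> fms \<theta> \<and> (u, RCompl (RVar r), w) \<in> fms \<theta>"
  then have "(u, RVar r, w) \<in> leaf \<theta>" "(u, RCompl (RVar r), w) \<in> leaf \<theta>"
    by (auto intro: undecomposable_in_leaf)
  then show False
    using leaf_not_axiomatic by (auto simp: axiomatic_def Let_def)
qed

lemma comp_in_leaf: "(u, RComp B S, w) \<in> fms \<theta> \<Longrightarrow> (u, RComp B S, w) \<in> leaf \<theta>"
  by (rule undecomposable_in_leaf) auto

lemma comp_a_decomposed:
  assumes "(u, RComp B S, w) \<in> fms \<theta>" "B \<noteq> ROne" "z \<in> V (RCompl B) u (fms \<theta>)"
  shows "(z, S, w) \<in> fms \<theta>"
proof -
  have "CompA (u, RComp B S, w) z \<in> set (apps \<theta>)"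
    using not_permitted[of "CompA (u, RComp B S, w) z"] assms comp_in_leaf
    by (auto simp: permitted_def applicable_def)
  from apps_conclusions[OF branch this] show ?thesis
    using assms(2) by simp
qed

lemma comp_b_decomposed:
  assumes "(u, RComp ROne S, w) \<in> fms \<theta>" "z \<in> vars (leaf \<theta>)"
  shows "(z, S, w) \<in> fms \<theta>"
proof (rule ccontr)
  assume "(z, S, w) \<notin> fms \<theta>"
  then have "CompB (u, RComp ROne S, w) z \<in> set (apps \<theta>)"
    using not_permitted[of "CompB (u, RComp ROne S, w) z"] assms comp_in_leaf
    by (auto simp: permitted_def applicable_def)
  from apps_conclusions[OF branch this] show False
    using \<open>(z, S, w) \<notin> fms \<theta>\<close> by simp
qed

lemma neg_comp_decomposed:
  assumes "decomposed_with \<theta> (u, RCompl (RComp B S), w) z"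
  shows "B \<noteq> ROne \<Longrightarrow> (u, RCompl B, z) \<in> fms \<theta>" "S \<noteq> ROne \<Longrightarrow> (z, RCompl S, w) \<in> fms \<theta>"
  using apps_conclusions[OF branch assms[unfolded decomposed_with_def]]
  by (auto split: if_splits)

text \<open>An undecomposed formula is still in the leaf, and a fresh variable exists; so only
  blocking can have prevented its decomposition.\<close>

lemma neg_comp_cases:
  assumes "(u, RCompl (RComp B S), w) \<in> fms \<theta>" "B \<noteq> ROne"
  shows "(\<exists>z. decomposed_with \<theta> (u, RCompl (RComp B S), w) z) \<or>
    (\<exists>z' z. blocks \<theta> B S w z' z u \<and> \<not> (\<exists>z. decomposed_with \<theta> (u, RCompl (RComp B S), w) z))"
proof (rule ccontr)
  let ?\<phi> = "(u, RCompl (RComp B S), w)"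
  assume neg: "\<not> ?thesis"
  then have "?\<phi> \<in> leaf \<theta>"
    using mem_leaf_or_decomposed[OF branch assms(1)] apps_conclusions[OF branch, of "Boolean ?\<phi>"]
    by (auto simp: decomposed_with_def)
  moreover obtain z where "z \<notin> W \<theta>"
    using fresh_var[OF branch] by blast
  ultimately have "permitted \<theta> (NegComp ?\<phi> z)"
    using neg assms(2) by (auto simp: permitted_def applicable_def)
  then show False
    using not_permitted by blast
qed

text \<open>Blocking does not concern \<open>B = 1\<close>. If the formula is undecomposed, its side
  condition failed, and this failure itself provides the witness.\<close>

lemma neg_one_decomposed:
  assumes "(u, RCompl (RComp ROne S), w) \<in> fms \<theta>" "S \<noteq> ROne"
  shows "\<exists>z. (z, RCompl S, w) \<in> fms \<theta>"
proof (cases "\<exists>z. decomposed_with \<theta> (u, RCompl (RComp ROne S), w) z")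
  case True
  then show ?thesis
    using neg_comp_decomposed(2) assms(2) by blast
next
  let ?\<phi> = "(u, RCompl (RComp ROne S), w)"
  case False
  then have leaf: "?\<phi> \<in> leaf \<theta>"
    using mem_leaf_or_decomposed[OF branch assms(1)] apps_conclusions[OF branch, of "Boolean ?\<phi>"]
    by (auto simp: decomposed_with_def)
  obtain z where z: "z \<notin> W \<theta>"
    using fresh_var[OF branch] by blast
  have "\<not> blocked \<theta> (NegComp ?\<phi> z)"
    by (simp add: blocks_def)
  then have "\<not> side_condition \<theta> (NegComp ?\<phi> z)"
    using not_permitted[of "NegComp ?\<phi> z"] leaf False assms(2)
    by (auto simp: permitted_def applicable_def)
  then show ?thesis
    using z by auto
qed

section \<open>Survival of the object variables in the leaf\<close>

lemma pos_literal:
  assumes "pos_bool_term B" "(u, RCompl B, w) \<in> fms \<theta>"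
  shows "\<exists>r. (u, RCompl (RVar r), w) \<in> fms \<theta>"
  using assms
proof (induction B)
  case (RUnion R S)
  then show ?case using boolean_decomposed[of "(u, RCompl (RUnion R S), w)"] by auto
next
  case (RInter R S)
  then show ?case using boolean_decomposed[of "(u, RCompl (RInter R S), w)"] by auto
qed auto

lemma introduced_in_leaf:
  assumes "(u, RCompl B, w) \<in> fms \<theta>" "pos_bool_term B"
  shows "u \<in> vars (leaf \<theta>)" "w \<in> vars (leaf \<theta>)"
proof -
  obtain r where "(u, RCompl (RVar r), w) \<in> fms \<theta>"
    using pos_literal assms by blast
  then have "(u, RCompl (RVar r), w) \<in> leaf \<theta>"
    by (rule undecomposable_in_leaf) auto
  then show "u \<in> vars (leaf \<theta>)" "w \<in> vars (leaf \<theta>)"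
    by (auto dest: mem_vars)
qed

text \<open>Boolean rules leave a smaller formula with the same left variable, and
  \<open>(-;)\<close>-rules leave \<open>u(-B)z\<close>, whose literals persist. Formulae
  \<open>u(-(1;S))y\<close>, whose decomposition drops \<open>u\<close>, are excluded by
  \<open>u \<noteq> x\<close>.\<close>

lemma left_var_in_leaf:
  assumes "(u, R, w) \<in> fms \<theta>" "u \<noteq> x"
  shows "u \<in> vars (leaf \<theta>)"
  using assms
proof (induction R arbitrary: w rule: measure_induct_rule[of size])
  case (less R)
  consider "(u, R, w) \<in> leaf \<theta>" | "Boolean (u, R, w) \<in> set (apps \<theta>)"
    | z where "NegComp (u, R, w) z \<in> set (apps \<theta>)"
    using mem_leaf_or_decomposed[OF branch less.prems(1)] by blast
  then show ?case
  proof cases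
    case 1
    then show ?thesis using mem_vars by blast
  next
    case 2
    then obtain \<Gamma> where "\<Gamma> \<in> set (conclusions (Boolean (u, R, w)))" "\<Gamma> \<subseteq> fms \<theta>"
      using apps_conclusions[OF branch] by blast
    then have "\<exists>Q. (u, Q, w) \<in> fms \<theta> \<and> size Q < size R"
      by (cases rule: conclusions_cases) force+
    then show ?thesis using less by blast
  next
    case 3
    then obtain \<Gamma> where "\<Gamma> \<in> set (conclusions (NegComp (u, R, w) z))" "\<Gamma> \<subseteq> fms \<theta>"
      using apps_conclusions[OF branch] by blast
    then show ?thesis
      using fragment[OF less.prems(1)] less.prems introduced_in_leaf(1)
      by (cases rule: conclusions_cases) (auto split: if_splits)
  qed
qed

text \<open>\<open>CompB\<close> instantiates with the variables of the current node only, whereas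
  the universe of the model is \<open>W \<theta>\<close>; this closes the gap.\<close>

lemma W_in_leaf:
  assumes "(x, R, y) \<in> leaf \<theta>"
  shows "W \<theta> \<subseteq> vars (leaf \<theta>)"
proof
  fix c
  assume "c \<in> W \<theta>"
  show "c \<in> vars (leaf \<theta>)"
  proof (cases "c \<in> {x, y}")
    case True
    then show ?thesis using mem_vars[OF assms] by auto
  next
    case False
    then obtain \<phi> where "NegComp \<phi> c \<in> set (apps \<theta>)"
      using W_subset[OF branch] \<open>c \<in> W \<theta>\<close> by (auto simp: set_introduced)
    then obtain \<Gamma> where "\<Gamma> \<in> set (conclusions (NegComp \<phi> c))" "\<Gamma> \<subseteq> fms \<theta>"
      using apps_conclusions[OF branch] by blast
    then show ?thesis
    proof (cases rule: conclusions_cases)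
      case (neg_one u S w z)
      then have "(c, RCompl S, w) \<in> fms \<theta>"
        using \<open>\<Gamma> \<subseteq> fms \<theta>\<close> by auto
      then show ?thesis using left_var_in_leaf False by blast
    next
      case (neg_comp u B S w z)
      then have "(u, RCompl B, c) \<in> fms \<theta>"
        using \<open>\<Gamma> \<subseteq> fms \<theta>\<close> by auto
      then show ?thesis using fragment[of u "RCompl B" c] introduced_in_leaf(2)[of u B c] False by auto
    qed auto
  qed
qed

section \<open>The countermodel and its truth lemma\<close>

abbreviation M where "M \<equiv> branch_model \<theta>"

lemma fst_M: "fst M = W \<theta>"
  by (simp add: branch_model_def)

lemma mem_M: "(a, b) \<in> snd M r \<longleftrightarrow>
    a \<in> W \<theta> \<and> b \<in> W \<theta> \<and> ((a, RCompl (RVar r), b) \<in> fms \<theta> \<or> (a, RCompl (RVar r), b) \<in> blocked_lits \<theta>)"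
  by (auto simp: branch_model_def branch_lits_def)

lemma M_model: "is_model M"
  using root_vars[OF branch] by (auto simp: is_model_def branch_model_def)

lemma mem_W: "(u, R, w) \<in> fms \<theta> \<Longrightarrow> u \<in> W \<theta> \<and> w \<in> W \<theta>"
  unfolding W_def by (rule mem_vars)

lemma blocks_facts:
  assumes "blocks \<theta> B S v z' w z"
  shows "v = y" "pos_bool_term B" "(z', RCompl B, w) \<in> fms \<theta>" "w \<noteq> y" "z \<in> W \<theta>"
    "w \<in> W \<theta>" "S \<noteq> ROne \<Longrightarrow> (w, RCompl S, y) \<in> fms \<theta>"
proof -
  have b: "B \<noteq> ROne" "(z', RCompl (RComp B S), v) \<in> fms \<theta>" "(z, RCompl (RComp B S), v) \<in> fms \<theta>"
    "decomposed_with \<theta> (z', RCompl (RComp B S), v) w"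
    using assms by (auto simp: blocks_def)
  show "v = y" "pos_bool_term B"
    using fragment[OF b(2)] b(1) by (auto split: if_splits)
  show "(z', RCompl B, w) \<in> fms \<theta>"
    using neg_comp_decomposed(1)[OF b(4,1)] .
  show "w \<noteq> y"
    using introduced_var(2)[OF branch] b(4) by (auto simp: decomposed_with_def)
  show "z \<in> W \<theta>" "w \<in> W \<theta>"
    using mem_W b(3) \<open>(z', RCompl B, w) \<in> fms \<theta>\<close> by blast+
  show "S \<noteq> ROne \<Longrightarrow> (w, RCompl S, y) \<in> fms \<theta>"
    using neg_comp_decomposed(2)[OF b(4)] \<open>v = y\<close> by simp
qed

text \<open>The literals left by the decomposition of \<open>u(-B)w\<close> suffice to make
  \<open>B\<close> true. The separate \<open>u'\<close> allows for a blocked variable to which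
  copies of these literals are attached.\<close>

lemma pos_interp_M:
  assumes "pos_bool_term B" "(u, RCompl B, w) \<in> fms \<theta>"
    and "\<And>r. (u, RCompl (RVar r), w) \<in> fms \<theta> \<Longrightarrow> (u', w) \<in> snd M r"
  shows "(u', w) \<in> interp M B"
  using assms(1,2)
proof (induction B)
  case (RVar r)
  then show ?case using assms(3) by simp
next
  case (RUnion R S)
  then show ?case using boolean_decomposed[of "(u, RCompl (RUnion R S), w)"] by auto
next
  case (RInter R S)
  then show ?case using boolean_decomposed[of "(u, RCompl (RInter R S), w)"] by auto
qed auto

lemma right_var_unique:
  assumes "(u, R, w) \<in> fms \<theta>" "NegComp (v, Q, v') w \<in> set (apps \<theta>)"
  shows "u = v"
proof -
  have "w \<noteq> y"
    using introduced_var(2)[OF branch assms(2)] .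
  then show ?thesis
    using right_var_introduced[OF branch outer assms(1)] introduced_unique[OF branch _ assms(2)]
    by blast
qed

text \<open>If no recorded literal relates \<open>u\<close> to \<open>c\<close>, the
  Bool-construction is available on the branch. Otherwise it is carried out at the blocking variable
  \<open>z'\<close> instead.\<close>

lemma interp_imp_comp_a:
  assumes "(u, RComp B S, y) \<in> fms \<theta>" "pos_bool_term B" "(u, c) \<in> interp M B"
  shows "(c, S, y) \<in> fms \<theta>"
proof (cases "\<exists>r. (u, RCompl (RVar r), c) \<in> blocked_lits \<theta>")
  case False
  then have "c \<in> V (RCompl B) u (fms \<theta>)"
    using mem_M by (intro pos_interp_V[OF assms(2,3)]) blast
  then show ?thesis
    using comp_a_decomposed assms(1,2) by fastforce
next
  case True
  then obtain B0 S0 v z' where bl: "blocks \<theta> B0 S0 v z' c u"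
    by (auto simp: blocked_lits_def)
  have v: "v = y"
    using blocks_facts(1)[OF bl] .
  have app: "NegComp (z', RCompl (RComp B0 S0), v) c \<in> set (apps \<theta>)" and "z' \<noteq> u"
    using bl by (auto simp: blocks_def decomposed_with_def)
  \<comment> \<open>Several blocked formulae of \<open>u\<close> may record literals with right
    variable \<open>c\<close>, but \<open>c\<close> was created at \<open>z'\<close> only, so all of
    them are copies from \<open>z'\<close>. As \<open>z' \<noteq> u\<close>, the branch itself has
    no literal from \<open>u\<close> to \<open>c\<close>.\<close>
  have lit: "(z', RCompl (RVar r), c) \<in> fms \<theta>" if uc: "(u, c) \<in> snd M r" for r
  proof -
    have "(u, RCompl (RVar r), c) \<notin> fms \<theta>"
      using right_var_unique[OF _ app] \<open>z' \<noteq> u\<close> by blast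
    then obtain B1 S1 v1 z'' where bl1: "blocks \<theta> B1 S1 v1 z'' c u"
      and r: "(z'', RCompl (RVar r), c) \<in> fms \<theta>"
      using uc mem_M[of u c r] by (auto simp: blocked_lits_def)
    then show ?thesis
      using right_var_unique[OF r app] by simp
  qed
  have "bool_construction {(u, RCompl (RVar r), c) | r. (z', RCompl (RVar r), c) \<in> fms \<theta>}
      (u, RCompl B, c)"
    using lit by (intro pos_interp_V[OF assms(2,3)]) blast
  then have "(z', RComp B S, y) \<in> fms \<theta>"
    using bl assms(1) v by (auto simp: blocks_def)
  moreover have "c \<in> V (RCompl B) z' (fms \<theta>)"
    using lit by (intro pos_interp_V[OF assms(2,3)])
  ultimately show ?thesis
    using comp_a_decomposed assms(2) by fastforce
qed

text \<open>The induction is on size because the rules lead from \<open>-(R \<union> S)\<close> to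
  \<open>-R\<close>, which is smaller but not a subterm.\<close>

lemma branch_falsified:
  assumes "(u, R, w) \<in> fms \<theta>"
  shows "(u, w) \<notin> interp M R"
  using assms
proof (induction R arbitrary: u w rule: measure_induct_rule[of size])
  case (less R)
  note uw = mem_W[OF less.prems]
  note frag = fragment[OF less.prems]
  show ?case
  proof (cases R)
    case (RVar r)
    \<comment> \<open>Uncomplemented variables occur with right variable \<open>y\<close> only,
      recorded literals never do; so recording cannot clash with \<open>urw\<close>.\<close>
    then have "w = y"
      using frag by (auto split: if_splits)
    then have "(u, RCompl (RVar r), w) \<notin> blocked_lits \<theta>"
      using blocks_facts(4) unfolding blocked_lits_def by blast
    then show ?thesis
      using no_complementary less.prems RVar mem_M by auto
  next
    case ROne
    then show ?thesis using no_one less.prems by blast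
  next
    case (RUnion Q S)
    then show ?thesis
      using boolean_decomposed[OF less.prems] less.IH[of Q u w] less.IH[of S u w] by auto
  next
    case (RInter Q S)
    then show ?thesis
      using boolean_decomposed[OF less.prems] less.IH[of Q u w] less.IH[of S u w] by auto
  next
    case (RComp B S)
    then have w: "w = y" and B: "B = ROne \<or> pos_bool_term B"
      using frag by (auto split: if_splits)
    have "(c, y) \<notin> interp M S" if c: "(u, c) \<in> interp M B" for c
    proof -
      have "(c, S, y) \<in> fms \<theta>"
      proof (cases "B = ROne")
        case True
        then have "u = x"
          using frag RComp w by auto
        then have "c \<in> vars (leaf \<theta>)"
          using c True W_in_leaf[of R] comp_in_leaf less.prems RComp w by (auto simp: fst_M)
        then show ?thesis
          using comp_b_decomposed less.prems RComp w True by blast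
      next
        case False
        then show ?thesis
          using interp_imp_comp_a less.prems RComp w B c by blast
      qed
      then show ?thesis
        using less.IH[of S] RComp by simp
    qed
    then show ?thesis using RComp w by auto
  next
    case (RCompl Q)
    have "(u, w) \<in> interp M Q"
    proof (cases Q)
      case (RVar r)
      then show ?thesis using mem_M uw less.prems RCompl by auto
    next
      case ROne
      then show ?thesis using uw by (simp add: fst_M)
    next
      case (RUnion S S')
      then show ?thesis
        using boolean_decomposed[OF less.prems] less.IH[of "RCompl S" u w]
          less.IH[of "RCompl S'" u w] RCompl uw by (auto simp: fst_M)
    next
      case (RInter S S')
      then show ?thesis
        using boolean_decomposed[OF less.prems] less.IH[of "RCompl S" u w]
          less.IH[of "RCompl S'" u w] RCompl uw by (auto simp: fst_M)
    next
      case (RCompl S)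
      then show ?thesis
        using boolean_decomposed[OF less.prems] less.IH[of S u w] \<open>R = RCompl Q\<close> uw
        by (auto simp: fst_M)
    next
      case (RComp B S)
      note R = \<open>R = RCompl Q\<close> RComp
      have w: "w = y"
        using frag R by (auto split: if_splits)
      \<comment> \<open>For \<open>S = 1\<close> the rules put no formula \<open>c(-S)y\<close> on
        the branch; membership of \<open>c\<close> in the universe then suffices.\<close>
      have *: "(c, y) \<in> interp M S" if "S \<noteq> ROne \<Longrightarrow> (c, RCompl S, y) \<in> fms \<theta>" "c \<in> W \<theta>" for c
        using that less.IH[of "RCompl S" c y] R uw w by (cases "S = ROne") (auto simp: fst_M)
      show ?thesis
      proof (cases "B = ROne")
        case True
        \<comment> \<open>The formula \<open>x(-(1;1))y\<close> is never decomposed, but any element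
          of the universe is a witness for it.\<close>
        have "\<exists>c\<in>W \<theta>. (c, y) \<in> interp M S"
        proof (cases "S = ROne")
          case True
          then show ?thesis using * uw w by blast
        next
          case False
          then obtain c where "(c, RCompl S, y) \<in> fms \<theta>"
            using neg_one_decomposed less.prems R True w by blast
          then show ?thesis using * mem_W by blast
        qed
        then show ?thesis using True RComp uw w by (auto simp: fst_M)
      next
        case False
        have "\<exists>c. (u, c) \<in> interp M B \<and> (c, y) \<in> interp M S"
          using neg_comp_cases[OF less.prems[unfolded R] False]
        proof (elim disjE exE conjE)
          fix c
          assume c: "decomposed_with \<theta> (u, RCompl (RComp B S), w) c"
          have "(u, RCompl B, c) \<in> fms \<theta>"
            using neg_comp_decomposed(1)[OF c False] .
          then have "(u, c) \<in> interp M B" "c \<in> W \<theta>"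
            using less.IH[of "RCompl B" u c] R mem_W by (auto simp: fst_M)
          then show ?thesis
            using * neg_comp_decomposed(2)[OF c] w by blast
        next
          fix z' c
          assume bl: "blocks \<theta> B S w z' c u"
            and nd: "\<not> (\<exists>z. decomposed_with \<theta> (u, RCompl (RComp B S), w) z)"
          \<comment> \<open>The formula at \<open>u\<close> is blocked and undecomposed, so the
            literals of \<open>z'\<close> are recorded for \<open>u\<close>.\<close>
          have "(u, c) \<in> snd M r" if "(z', RCompl (RVar r), c) \<in> fms \<theta>" for r
            using that bl nd blocks_facts(5,6)[OF bl] unfolding mem_M blocked_lits_def by blast
          then have "(u, c) \<in> interp M B"
            using pos_interp_M[OF blocks_facts(2,3)[OF bl]] by blast
          then show ?thesis
            using * blocks_facts(6,7)[OF bl] by blast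
        qed
        then show ?thesis using RComp w by auto
      qed
    qed
    then show ?thesis using RCompl by simp
  qed
qed

end


section \<open>Termination\<close>

definition branch_rel :: "ov \<Rightarrow> rterm \<Rightarrow> ov \<Rightarrow> (branch \<times> branch) set" where
  "branch_rel x P y = {(grow \<theta> a \<Gamma>, \<theta>) | \<theta> a \<Gamma>.
    proc_branch x P y \<theta> \<and> permitted \<theta> a \<and> \<Gamma> \<in> set (conclusions a)}"

locale infinite_branch =
  fixes x y :: ov and P :: rterm and f :: "nat \<Rightarrow> branch" and A :: "nat \<Rightarrow> rule_app"
    and G :: "nat \<Rightarrow> fm set"
  assumes outer: "outer_term P"
    and branch: "\<And>i. proc_branch x P y (f i)"
    and perm: "\<And>i. permitted (f i) (A i)"
    and concl: "\<And>i. G i \<in> set (conclusions (A i))"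
    and step: "\<And>i. f (Suc i) = grow (f i) (A i) (G i)"
begin

lemma fms_mono: "i \<le> j \<Longrightarrow> fms (f i) \<subseteq> fms (f j)"
  by (rule lift_Suc_mono_le[of "\<lambda>i. fms (f i)"]) (auto simp: step fms_grow)

lemma apps_mono: "i < j \<Longrightarrow> A i \<in> set (apps (f j))"
proof (induction j)
  case (Suc j)
  then show ?case by (cases "i = j") (auto simp: step apps_grow)
qed simp

lemma apps_subset: "set (apps (f i)) \<subseteq> set (apps (f 0)) \<union> range A"
  by (induction i) (auto simp: step apps_grow)

lemma not_decomposed: "A j = NegComp \<phi> z \<Longrightarrow> i < j \<Longrightarrow> A i \<noteq> NegComp \<phi> w"
  using perm[of j] apps_mono[of i j] by (auto simp: permitted_def decomposed_with_def)

text \<open>A permitted rule application has not been performed before.\<close>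

lemma inj_A: "inj A"
proof (rule linorder_injI)
  fix i j :: nat
  assume "i < j"
  have "A j \<notin> set (apps (f j))"
    using perm[of j] by (cases "A j") (auto simp: permitted_def decomposed_with_def)
  then show "A i \<noteq> A j"
    using apps_mono[OF \<open>i < j\<close>] by metis
qed

lemma NegComp_mem: "A i = NegComp \<phi> z \<Longrightarrow> \<phi> \<in> fms (f i)"
  using permitted_premise[OF perm[of i]] by simp

lemma NegComp_term: "A i = NegComp \<phi> z \<Longrightarrow> \<exists>u B S w. \<phi> = (u, RCompl (RComp B S), w)"
  using permitted_NegComp[of "f i" \<phi> z] perm[of i] by simp

text \<open>\<open>?F u\<close> is the set of terms that \<open>u\<close> carries in the limit, for
  right variable \<open>y\<close>. Two variables with equal limits are found, one decomposed after
  the other has received its whole limit.\<close>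

lemma finite_decomposed:
  "finite {u. \<exists>i z. A i = NegComp (u, R, y) z}"
proof (rule ccontr)
  let ?Z = "{u. \<exists>i z. A i = NegComp (u, R, y) z}"
  let ?F = "\<lambda>u. {Q. \<exists>i. (u, Q, y) \<in> fms (f i)}"
  assume inf: "infinite ?Z"
  then obtain u i z where "A i = NegComp (u, R, y) z"
    using not_finite_existsD by blast
  then obtain B S where R: "R = RCompl (RComp B S)"
    using NegComp_term by blast
  have "B \<noteq> ROne"
  proof
    assume "B = ROne"
    then have "?Z \<subseteq> {x}"
      using fms_fragment[OF branch outer NegComp_mem] R by fastforce
    then show False
      using inf finite_subset by blast
  qed
  have F_subset: "?F u \<subseteq> closure_terms P" for u
    using fms_closure_terms[OF branch] by fastforce
  then have "finite (?F ` ?Z)"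
    by (intro finite_subset[OF _ finite_Pow_iff[THEN iffD2, OF finite_closure_terms[of P]]]) auto
  from pigeonhole_infinite[OF inf this] obtain z' where z': "z' \<in> ?Z"
    and inf': "infinite {u \<in> ?Z. ?F u = ?F z'}"
    by blast
  from z' obtain n' w where n': "A n' = NegComp (z', R, y) w"
    by blast
  have "finite (?F z')"
    using F_subset finite_closure_terms finite_subset by blast
  moreover have "\<forall>Q\<in>?F z'. \<exists>i. (z', Q, y) \<in> fms (f i)"
    by blast
  ultimately obtain g where g: "\<forall>Q\<in>?F z'. (z', Q, y) \<in> fms (f (g Q))"
    by metis
  obtain n0 where n0: "\<forall>Q\<in>?F z'. g Q \<le> n0"
    using finite_nat_set_iff_bounded_le[of "g ` ?F z'"] \<open>finite (?F z')\<close> by auto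
  \<comment> \<open>At this stage \<open>z'\<close> carries all of its limit terms and, thanks to
    the successor, its formula has been decomposed.\<close>
  define n where "n = Suc (max n0 n')"
  have exhausted: "(z', Q, y) \<in> fms (f n)" if "Q \<in> ?F z'" for Q
  proof -
    have "g Q \<le> n"
      using n0 that by (auto simp: n_def intro: le_SucI max.coboundedI1)
    then show ?thesis
      using g that fms_mono by blast
  qed
  \<comment> \<open>Only finitely many variables have had their turn before stage \<open>n\<close>,
    so infinitely many with the same limit remain.\<close>
  define D where "D = {u. \<exists>i<n. \<exists>z. A i = NegComp (u, R, y) z}"
  have "D \<subseteq> (\<lambda>i. fst (premise (A i))) ` {..<n}"
    by (force simp: D_def)
  then have "finite D"
    by (rule finite_subset) simp
  then have "\<not> {u \<in> ?Z. ?F u = ?F z'} \<subseteq> D"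
    using inf' finite_subset by blast
  then obtain z where z: "z \<in> ?Z" "?F z = ?F z'" "z \<notin> D"
    by blast
  then obtain m w' where m: "A m = NegComp (z, R, y) w'"
    by blast
  have "n \<le> m"
    using z(3) m not_le unfolding D_def by blast
  have "n' < m"
    using \<open>n \<le> m\<close> by (auto simp: n_def)
  have "z \<noteq> z'"
    using not_decomposed[OF m \<open>n' < m\<close>] n' by blast
  moreover have "(z', R, y) \<in> fms (f m)"
    using NegComp_mem[OF n'] fms_mono[of n' m] \<open>n' < m\<close> by auto
  moreover have "(z, R, y) \<in> fms (f m)"
    using NegComp_mem[OF m] .
  moreover have "decomposed_with (f m) (z', R, y) w"
    using apps_mono[OF \<open>n' < m\<close>] n' by (simp add: decomposed_with_def)
  \<comment> \<open>Stronger than the last condition of \<open>blocks\<close>: it covers every term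
    of \<open>z\<close>, whether or not a Bool-construction exists.\<close>
  moreover have "(z', Q, y) \<in> fms (f m)" if "(z, Q, y) \<in> fms (f m)" for Q
  proof -
    have "Q \<in> ?F z'"
      using that z(2) by blast
    then show ?thesis
      using exhausted fms_mono[OF \<open>n \<le> m\<close>] by blast
  qed
  ultimately have "blocks (f m) B S y z' w z"
    unfolding blocks_def R using \<open>B \<noteq> ROne\<close> by blast
  then have "blocked (f m) (A m)"
    using m R by auto
  then show False
    using perm[of m] by (simp add: permitted_def)
qed

text \<open>Each premise is decomposed once, so it suffices to count premises: finitely many terms,
  each with finitely many left variables and right variable \<open>y\<close>.\<close>

lemma finite_NegComp: "finite {i. \<exists>\<phi> z. A i = NegComp \<phi> z}" (is "finite ?I")
proof (rule finite_imageD)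
  let ?Z = "\<lambda>R. {u. \<exists>i z. A i = NegComp (u, R, y) z}"
  have "(premise \<circ> A) ` ?I \<subseteq> (\<Union>R\<in>closure_terms P. ?Z R \<times> {R} \<times> {y})"
  proof (clarsimp)
    fix i u R w z
    assume A: "A i = NegComp (u, R, w) z"
    have "R \<in> closure_terms P"
      using fms_closure_terms[OF branch NegComp_mem[OF A]] by simp
    moreover have "w = y"
      using fms_fragment[OF branch outer NegComp_mem[OF A]] NegComp_term[OF A]
      by (auto split: if_splits)
    ultimately show "R \<in> closure_terms P \<and> (\<exists>i z. A i = NegComp (u, R, y) z) \<and> w = y"
      using A by blast
  qed
  then show "finite ((premise \<circ> A) ` ?I)"
    by (rule finite_subset) (auto simp: finite_closure_terms finite_decomposed)
  show "inj_on (premise \<circ> A) ?I"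
    by (rule linorder_inj_onI) (use not_decomposed in fastforce)+
qed

text \<open>Finitely many \<open>(-;)\<close>-steps create finitely many variables, hence finitely
  many formulae and rule applications, against the injectivity of \<open>A\<close>.\<close>

lemma contradiction: False
proof -
  let ?I = "{i. \<exists>\<phi> z. A i = NegComp \<phi> z}"
  \<comment> \<open>The default \<open>x\<close> merely makes the function total; on
    \<open>?I\<close> the first case applies.\<close>
  let ?var = "\<lambda>a. case a of NegComp \<phi> z \<Rightarrow> z | _ \<Rightarrow> x"
  define U where "U = {x, y} \<union> set (introduced (f 0)) \<union> (?var \<circ> A) ` ?I"
  define F where "F = U \<times> closure_terms P \<times> U"
  have U: "finite U"
    using finite_NegComp by (simp add: U_def)
  have W: "W (f i) \<subseteq> U" for i
  proof -
    have "set (introduced (f i)) \<subseteq> set (introduced (f 0)) \<union> (?var \<circ> A) ` ?I"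
    proof
      fix z
      assume "z \<in> set (introduced (f i))"
      then obtain \<phi> where "NegComp \<phi> z \<in> set (apps (f i))"
        by (auto simp: set_introduced)
      then consider "NegComp \<phi> z \<in> set (apps (f 0))" | j where "A j = NegComp \<phi> z"
        using apps_subset by fastforce
      then show "z \<in> set (introduced (f 0)) \<union> (?var \<circ> A) ` ?I"
      proof cases
        case 1
        then show ?thesis unfolding set_introduced by blast
      next
        case 2
        then have "j \<in> ?I"
          by blast
        moreover have "(?var \<circ> A) j = z"
          using 2 by simp
        ultimately show ?thesis by blast
      qed
    qed
    then show ?thesis
      using W_subset[OF branch[of i]] by (auto simp: U_def)
  qed
  have F: "fms (f i) \<subseteq> F" for i
  proof
    fix \<phi>
    assume "\<phi> \<in> fms (f i)"
    then show "\<phi> \<in> F"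
      using fms_closure_terms[OF branch] W[of i] mem_vars[of "fst \<phi>" "fst (snd \<phi>)" "snd (snd \<phi>)"]
      by (cases \<phi>) (fastforce simp: F_def W_def)
  qed
  have "A i \<in> Boolean ` F \<union> (\<lambda>(\<phi>, z). NegComp \<phi> z) ` (F \<times> U)
      \<union> (\<lambda>(\<phi>, z). CompA \<phi> z) ` (F \<times> U) \<union> (\<lambda>(\<phi>, z). CompB \<phi> z) ` (F \<times> U)" for i
  proof -
    have prem: "premise (A i) \<in> F"
      using permitted_premise[OF perm[of i]] F by blast
    \<comment> \<open>The variable a rule is applied with occurs in each of its conclusion
      sets.\<close>
    have "vars (G i) \<subseteq> U"
      using W[of "Suc i"] by (simp add: step W_grow)
    with concl[of i] prem show ?thesis
      by (cases rule: conclusions_cases) (auto simp: vars_def image_iff split: if_splits)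
  qed
  then have "range A \<subseteq> Boolean ` F \<union> (\<lambda>(\<phi>, z). NegComp \<phi> z) ` (F \<times> U)
      \<union> (\<lambda>(\<phi>, z). CompA \<phi> z) ` (F \<times> U) \<union> (\<lambda>(\<phi>, z). CompB \<phi> z) ` (F \<times> U)"
    by blast
  moreover have "finite F"
    using U finite_closure_terms by (simp add: F_def)
  ultimately have "finite (range A)"
    using U by (meson finite_SigmaI finite_UnI finite_imageI finite_subset)
  then show False
    using inj_A finite_imageD infinite_UNIV_nat by blast
qed

end

lemma wf_branch_rel:
  assumes "outer_term P"
  shows "wf (branch_rel x P y)"
  unfolding wf_iff_no_infinite_down_chain
proof
  assume "\<exists>f. \<forall>i. (f (Suc i), f i) \<in> branch_rel x P y"
  then obtain f where "\<forall>i. \<exists>a \<Gamma>. f (Suc i) = grow (f i) a \<Gamma> \<and> proc_branch x P y (f i) \<and>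
      permitted (f i) a \<and> \<Gamma> \<in> set (conclusions a)"
    unfolding branch_rel_def by blast
  then obtain A G where "\<forall>i. f (Suc i) = grow (f i) (A i) (G i) \<and> proc_branch x P y (f i) \<and>
      permitted (f i) (A i) \<and> G i \<in> set (conclusions (A i))"
    by metis
  then interpret infinite_branch x y P f A G
    using assms by unfold_locales auto
  show False by (rule contradiction)
qed


section \<open>The multiset of branches of a tree\<close>

fun branch_mset :: "dtree \<Rightarrow> branch multiset" where
  "branch_mset (Leaf N) = {#([], N)#}"
| "branch_mset (Inner N a ts) =
    (\<Sum>t\<leftarrow>ts. image_mset (\<lambda>(h, L). ((N, a) # h, L)) (branch_mset t))"

lemma set_branch_mset: "set_mset (branch_mset t) = branches t"
  by (induction t rule: branch_mset.induct) (auto simp: set_mset_sum_list)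

text \<open>Multiplicities matter: decomposing \<open>RInter R R\<close> gives two equal branches,
  and \<open>extend\<close> replaces a single copy.\<close>

lemma branch_mset_extend:
  assumes "extend t \<theta> a t'"
  shows "\<exists>K. branch_mset t = K + {#\<theta>#} \<and>
    branch_mset t' = K + mset (map (grow \<theta> a) (conclusions a))"
  using assms
proof induction
  case (here N a)
  have "(\<Sum>t\<leftarrow>map Leaf Ns. image_mset (\<lambda>(h, L). ((N, a) # h, L)) (branch_mset t)) =
      mset (map (\<lambda>L. ([(N, a)], L)) Ns)" for Ns
    by (induction Ns) auto
  then show ?case
    by (intro exI[of _ "{#}"]) (simp add: successors_def o_def grow_def leaf_def)
next
  case (below t h L a t' N b ts us)
  let ?c = "\<lambda>(h, L). ((N, b) # h, L)"
  obtain K where K: "branch_mset t = K + {#(h, L)#}"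
    "branch_mset t' = K + mset (map (grow (h, L) a) (conclusions a))"
    using below.IH by blast
  have g: "grow ((N, b) # h, L) a = ?c \<circ> grow (h, L) a"
    by (rule ext) (simp add: grow_def leaf_def)
  let ?R = "(\<Sum>t\<leftarrow>ts. image_mset ?c (branch_mset t)) + (\<Sum>t\<leftarrow>us. image_mset ?c (branch_mset t))"
  show ?case
    by (rule exI[of _ "?R + image_mset ?c K"]) (simp add: K g multiset.map_comp o_def)
qed

lemma extend_exists:
  assumes "\<theta> \<in> branches t"
  shows "\<exists>t'. extend t \<theta> a t'"
  using assms
proof (induction t arbitrary: \<theta>)
  case (Leaf N)
  then show ?case using extend.here by auto
next
  case (Inner N b ts)
  then obtain t h L where t: "t \<in> set ts" "(h, L) \<in> branches t" "\<theta> = ((N, b) # h, L)"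
    by auto
  then obtain t' where "extend t (h, L) a t'"
    using Inner.IH by blast
  moreover obtain us vs where "ts = us @ t # vs"
    using t(1) split_list by fast
  ultimately show ?case
    using extend.below t(3) by blast
qed

lemma branches_extend:
  assumes "extend t \<theta> a t'"
  shows "\<theta> \<in> branches t" "branches t' \<subseteq> branches t \<union> grow \<theta> a ` set (conclusions a)"
    "grow \<theta> a ` set (conclusions a) \<subseteq> branches t'" "branches t - {\<theta>} \<subseteq> branches t'"
  using branch_mset_extend[OF assms] by (auto simp flip: set_branch_mset)

text \<open>One branch is replaced by finitely many smaller ones, as in the Dershowitz-Manna
  order.\<close>

lemma branch_mset_decreases:
  assumes "extend t \<theta> a t'" "permitted \<theta> a" "proc_branch x P y \<theta>"
  shows "(branch_mset t', branch_mset t) \<in> mult (branch_rel x P y)"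
proof -
  obtain K where K: "branch_mset t = K + {#\<theta>#}"
    "branch_mset t' = K + mset (map (grow \<theta> a) (conclusions a))"
    using branch_mset_extend[OF assms(1)] by blast
  have "(grow \<theta> a \<Gamma>, \<theta>) \<in> branch_rel x P y" if "\<Gamma> \<in> set (conclusions a)" for \<Gamma>
    unfolding branch_rel_def using assms(2,3) that by blast
  then show ?thesis
    unfolding K by (intro one_step_implies_mult) auto
qed


section \<open>Runs of the procedure\<close>

fun state_tree :: "state \<Rightarrow> dtree" where
  "state_tree (Choose t) = t"
| "state_tree (Loop t \<theta>) = t"
| "state_tree (Decompose t \<theta> z) = t"
| "state_tree (Closed t) = t"
| "state_tree (Returned t \<theta> M v) = t"

text \<open>Decreases along every step that does not extend the tree.\<close>

fun state_rank :: "state \<Rightarrow> nat" where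
  "state_rank (Decompose t \<theta> z) = (if axiomatic_branch \<theta> \<or> z \<notin> pending \<theta> then 5 else 1)"
| "state_rank (Loop t \<theta>) = (if axiomatic_branch \<theta> then 4 else 2)"
| "state_rank (Choose t) = 3"
| "state_rank _ = 0"

fun state_branch_ok :: "state \<Rightarrow> bool" where
  "state_branch_ok (Choose t) \<longleftrightarrow> True"
| "state_branch_ok (Loop t \<theta>) \<longleftrightarrow> \<theta> \<in> branches t"
| "state_branch_ok (Decompose t \<theta> z) \<longleftrightarrow> \<theta> \<in> branches t"
| "state_branch_ok (Closed t) \<longleftrightarrow> (\<forall>\<theta>\<in>branches t. axiomatic_branch \<theta>)"
| "state_branch_ok (Returned t \<theta> M v) \<longleftrightarrow> \<theta> \<in> branches t \<and> \<not> axiomatic_branch \<theta> \<and>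
    \<not> expandable \<theta> \<and> M = branch_model \<theta> \<and> is_valuation M v \<and> (\<forall>u\<in>W \<theta>. v u = u)"

text \<open>The invariant of a run. The countermodel \<open>M\<close> of the initial formula is
  fixed, whereas the refuted branch and the valuation may change from step to step.\<close>

definition state_ok :: "ov \<Rightarrow> rterm \<Rightarrow> ov \<Rightarrow> 'u model \<Rightarrow> state \<Rightarrow> bool" where
  "state_ok x P y M s \<longleftrightarrow> deduction_tree (x, P, y) (state_tree s) \<and>
    (\<forall>\<theta>\<in>branches (state_tree s). proc_branch x P y \<theta>) \<and>
    (\<exists>\<theta>\<in>branches (state_tree s). \<exists>v. falsifies M v (fms \<theta>)) \<and> state_branch_ok s"

lemma falsifies_not_axiomatic_branch:
  assumes "falsifies M v (fms \<theta>)"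
  shows "\<not> axiomatic_branch \<theta>"
proof
  assume "axiomatic_branch \<theta>"
  then obtain N where "N \<in> set (nodes \<theta>)" "axiomatic N"
    by (auto simp: axiomatic_branch_def)
  moreover have "falsifies M v N"
    using assms \<open>N \<in> set (nodes \<theta>)\<close> unfolding falsifies_def fms_def by blast
  ultimately show False
    using falsifies_not_axiomatic by blast
qed

lemma state_ok_start:
  assumes "falsifies M v {(x, P, y)}"
  shows "state_ok x P y M (start (x, P, y))"
  using assms
  by (auto simp: state_ok_def start_def deduction_tree.initial proc_branch.initial
      fms_def nodes_def)

lemma state_ok_step:
  assumes "is_model M" "state_ok x P y M s" "proc_step x y s s'"
  shows "state_ok x P y M s'"
  using assms(3)
proof cases
  case (apply_rule \<theta> a z t t' N')
  have ok: "deduction_tree (x, P, y) t" "\<And>\<theta>. \<theta> \<in> branches t \<Longrightarrow> proc_branch x P y \<theta>"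
    using assms(2) apply_rule by (auto simp: state_ok_def)
  obtain \<theta>0 v where \<theta>0: "\<theta>0 \<in> branches t" "falsifies M v (fms \<theta>0)"
    using assms(2) apply_rule by (auto simp: state_ok_def)
  note ext = branches_extend[OF \<open>extend t \<theta> a t'\<close>]
  have app: "applicable \<theta> a"
    using apply_rule by (simp add: permitted_def)
  have "leaf \<theta> \<in> set (nodes \<theta>)"
    by (simp add: nodes_def leaf_def)
  then have "\<not> axiomatic (leaf \<theta>)"
    using apply_rule by (auto simp: axiomatic_branch_def)
  then have "deduction_tree (x, P, y) t'"
    using deduction_tree.step ok(1) app apply_rule by blast
  moreover have "proc_branch x P y \<theta>'" if "\<theta>' \<in> branches t'" for \<theta>'
    using that ext(1,2) ok(2) proc_branch.grow apply_rule by blast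
  moreover have "\<exists>\<theta>\<in>branches t'. \<exists>v. falsifies M v (fms \<theta>)"
  \<comment> \<open>Extending the refuted branch is covered by soundness; otherwise that branch
    survives untouched.\<close>
  proof (cases "\<theta>0 = \<theta>")
    case True
    then show ?thesis
      using falsifies_grow[OF assms(1) _ app] \<theta>0(2) ext(3) by blast
  next
    case False
    then show ?thesis
      using \<theta>0 ext(4) by blast
  qed
  moreover have "(fst \<theta> @ [(leaf \<theta>, a)], N') \<in> branches t'"
    using apply_rule ext(3) by (auto simp: successors_def grow_def)
  ultimately show ?thesis
    using apply_rule by (simp add: state_ok_def)
qed (use assms(2) in \<open>auto simp: state_ok_def\<close>)

lemma state_ok_reachable:
  assumes "(proc_step x y)\<^sup>*\<^sup>* s s'" "is_model M" "state_ok x P y M s"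
  shows "state_ok x P y M s'"
  using assms by (induction) (auto intro: state_ok_step)

text \<open>Only \<open>apply_rule\<close> changes the tree, and it lowers the multiset. All other
  steps lower the rank; for \<open>next_var\<close> this holds because the smallest variable is
  pending.\<close>

lemma proc_step_decreases:
  assumes "proc_step x y s s'" "state_ok x P y M s"
  shows "((branch_mset (state_tree s'), state_rank s'), branch_mset (state_tree s), state_rank s)
    \<in> mult (branch_rel x P y) <*lex*> less_than"
  using assms(1)
proof cases
  case (apply_rule \<theta> a z t t' N')
  then have "proc_branch x P y \<theta>"
    using assms(2) by (simp add: state_ok_def)
  then show ?thesis
    using branch_mset_decreases apply_rule by simp
qed (auto simp: smallest_def)

lemma no_infinite_run:
  assumes "outer_term P" "is_model M" "state_ok x P y M (run 0)"
  shows "\<not> (\<forall>i::nat. proc_step x y (run i) (run (Suc i)))"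
proof
  assume step: "\<forall>i. proc_step x y (run i) (run (Suc i))"
  have ok: "state_ok x P y M (run i)" for i
    by (induction i) (use assms step state_ok_step in blast)+
  let ?m = "\<lambda>s. (branch_mset (state_tree s), state_rank s)"
  have "wf (mult (branch_rel x P y) <*lex*> less_than)"
    using wf_branch_rel[OF assms(1)] wf_mult wf_lex_prod wf_less_than by blast
  moreover have "(?m (run (Suc i)), ?m (run i)) \<in> mult (branch_rel x P y) <*lex*> less_than" for i
    using proc_step_decreases ok step by blast
  ultimately show False
    unfolding wf_iff_no_infinite_down_chain
    by (elim notE, intro exI[of _ "\<lambda>i. ?m (run i)"]) blast
qed


section \<open>Progress\<close>

text \<open>The conditions on a variable order determine the direction of every pair of variables, so
  two orders cannot disagree.\<close>

lemma variable_order_unique: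
  assumes br: "proc_branch x P y \<theta>" and "variable_order x y \<theta> r" "variable_order x y \<theta> r'"
    and "(a, b) \<in> r" "a \<in> W \<theta>" "b \<in> W \<theta>"
  shows "(a, b) \<in> r'"
proof -
  have no_loop: "(c, c) \<notin> r" for c
    using assms(2) by (simp add: variable_order_def strict_linear_order_on_def irrefl_def)
  have antisym: "(b, a) \<notin> r"
  proof
    have "trans r"
      using assms(2) by (simp add: variable_order_def strict_linear_order_on_def)
    moreover assume "(b, a) \<in> r"
    ultimately show False
      using assms(4) no_loop transD by metis
  qed
  have ab: "a \<noteq> b"
    using assms(4) no_loop by blast
  \<comment> \<open>Once one direction of the pair holds in every order, it must be the direction it
    has in \<open>r\<close>.\<close>
  let ?forced = "\<lambda>c d. \<forall>s. variable_order x y \<theta> s \<longrightarrow> (c, d) \<in> s"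
  have "?forced a b \<or> ?forced b a"
  proof (cases "a = x \<or> b = x")
    case True
    then show ?thesis
      using assms(5,6) ab by (auto simp: variable_order_def)
  next
    case nx: False
    show ?thesis
    proof (cases "a = y \<or> b = y")
      case True
      have "?forced y c \<or> ?forced c y" if "c \<in> W \<theta>" "c \<noteq> y" "x \<noteq> y" for c
        using that by (cases "descendant \<theta> y c") (auto simp: variable_order_def)
      then show ?thesis
        using True nx ab assms(5,6) by metis
    next
      case False
      then have "a \<in> set (introduced \<theta>)" "b \<in> set (introduced \<theta>)"
        using W_subset[OF br] assms(5,6) nx by auto
      then obtain i j where ij: "i < length (introduced \<theta>)" "introduced \<theta> ! i = a"
        "j < length (introduced \<theta>)" "introduced \<theta> ! j = b"
        by (metis in_set_conv_nth)
      then have "i \<noteq> j"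
        using ab by auto
      then have "introduced_before \<theta> a b \<or> introduced_before \<theta> b a"
        unfolding introduced_before_def using ij by (metis linorder_neqE_nat)
      then show ?thesis
        using False nx assms(5,6) by (auto simp: variable_order_def)
    qed
  qed
  then show ?thesis
    using assms(2,3) antisym by blast
qed

lemma pending_subset:
  assumes "proc_branch x P y \<theta>"
  shows "pending \<theta> \<subseteq> W \<theta>"
proof
  fix z
  assume "z \<in> pending \<theta>"
  then obtain a where a: "permitted \<theta> a" "z = app_var a"
    by (auto simp: pending_def)
  obtain u R w where prem: "premise a = (u, R, w)"
    by (cases "premise a") auto
  have "u \<in> W \<theta>"
    using permitted_premise[OF a(1)] prem mem_vars by (fastforce simp: W_def)
  moreover have "vars (leaf \<theta>) \<subseteq> W \<theta>"
    using leaf_subset_fms[of \<theta>] by (auto simp: W_def vars_def)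
  moreover have "z = u \<or> z \<in> vars (leaf \<theta>)"
  proof (cases a)
    case (CompB \<phi> c)
    then show ?thesis
      using a prem
      by (cases "(\<theta>, a)" rule: side_condition.cases) (auto simp: permitted_def applicable_def)
  qed (use a prem in auto)
  ultimately show "z \<in> W \<theta>"
    by blast
qed

lemma strict_linear_order_least:
  assumes "strict_linear_order_on A r" "finite Z" "Z \<noteq> {}" "Z \<subseteq> A"
  shows "\<exists>z\<in>Z. \<forall>w\<in>Z - {z}. (z, w) \<in> r"
  using assms(2-4)
proof (induction Z rule: finite_ne_induct)
  case (singleton c)
  then show ?case by simp
next
  case (insert c Z)
  then obtain z where z: "z \<in> Z" "\<forall>w\<in>Z - {z}. (z, w) \<in> r"
    by auto
  then have "(c, z) \<in> r \<or> (z, c) \<in> r" "c \<noteq> z"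
    using assms(1) insert.hyps insert.prems
    by (auto simp: strict_linear_order_on_def total_on_def)
  moreover have "trans r"
    using assms(1) by (simp add: strict_linear_order_on_def)
  ultimately show ?case
    using z by (metis (no_types, lifting) Diff_iff insert_iff singletonD transD)
qed

lemma smallest_exists:
  assumes br: "proc_branch x P y \<theta>" and "expandable \<theta>"
  shows "\<exists>z. smallest x y \<theta> (pending \<theta>) z"
proof (cases "\<exists>r. variable_order x y \<theta> r")
  case True
  then obtain r where r: "variable_order x y \<theta> r" by blast
  have "pending \<theta> \<noteq> {}"
    using assms(2) by (auto simp: expandable_def pending_def)
  moreover have "finite (pending \<theta>)"
    using pending_subset[OF br] finite_W[OF br] finite_subset by blast
  moreover have "strict_linear_order_on (W \<theta>) r"
    using r by (simp add: variable_order_def)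
  ultimately obtain z where z: "z \<in> pending \<theta>" "\<forall>w\<in>pending \<theta> - {z}. (z, w) \<in> r"
    using strict_linear_order_least[of "W \<theta>" r] pending_subset[OF br] by blast
  have "(z, w) \<in> r'" if "variable_order x y \<theta> r'" "w \<in> pending \<theta> - {z}" for r' w
    using variable_order_unique[OF br r that(1)] z that(2) pending_subset[OF br] by blast
  with z(1) show ?thesis
    unfolding smallest_def by blast
next
  \<comment> \<open>Without any variable order, \<open>smallest\<close> holds of every pending
    variable.\<close>
  case False
  obtain z where "z \<in> pending \<theta>"
    using assms(2) unfolding expandable_def pending_def by blast
  with False show ?thesis
    unfolding smallest_def by blast
qed

text \<open>Progress: every other state has a successor, obtained from the smallest pending
  variable, a permitted application of least phase, or a valuation for the returned model.\<close>

lemma terminal_cases: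
  assumes "state_ok x P y M s" "terminal x y s"
  obtains t where "s = Closed t" | t \<theta> N v where "s = Returned t \<theta> N v"
proof -
  have "\<exists>s'. proc_step x y s s'" if "s = Choose t" for t
    using that proc_step.choose proc_step.tree_closed by blast
  moreover have "\<exists>s'. proc_step x y s s'" if s: "s = Loop t \<theta>" for t \<theta>
  proof -
    have br: "proc_branch x P y \<theta>"
      using assms(1) s by (simp add: state_ok_def)
    consider "axiomatic_branch \<theta>" | "\<not> axiomatic_branch \<theta>" "expandable \<theta>"
      | "\<not> axiomatic_branch \<theta>" "\<not> expandable \<theta>"
      by blast
    then show ?thesis
    proof cases
      case 1
      then show ?thesis using s proc_step.branch_closed by blast
    next
      case 2
      then show ?thesis using s proc_step.next_var smallest_exists[OF br] by blast
    next
      case 3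
      \<comment> \<open>Variables off the branch need some value in the universe, and
        \<open>x\<close> always lies there.\<close>
      let ?v = "\<lambda>u. if u \<in> W \<theta> then u else x"
      have "is_valuation (branch_model \<theta>) ?v"
        using root_vars[OF br] by (auto simp: is_valuation_def branch_model_def)
      then show ?thesis
        using s proc_step.return[OF 3, of ?v] by auto
    qed
  qed
  moreover have "\<exists>s'. proc_step x y s s'" if s: "s = Decompose t \<theta> z" for t \<theta> z
  proof (cases "axiomatic_branch \<theta> \<or> z \<notin> pending \<theta>")
    case True
    then show ?thesis using s proc_step.saturated by blast
  next
    case False
    let ?Q = "\<lambda>a. permitted \<theta> a \<and> app_var a = z"
    obtain a where a: "?Q a" "\<forall>b. ?Q b \<longrightarrow> phase a \<le> phase b"
      using False ex_has_least_nat[of ?Q _ phase] by (auto simp: pending_def)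
    then obtain \<Gamma> where \<Gamma>: "\<Gamma> \<in> set (successors (leaf \<theta>) a)"
      by (cases "conclusions a") (auto simp: successors_def permitted_def applicable_def)
    have "\<theta> \<in> branches t"
      using assms(1) s by (simp add: state_ok_def)
    then obtain t' where "extend t \<theta> a t'"
      using extend_exists by blast
    then show ?thesis
      using s False a \<Gamma> proc_step.apply_rule by blast
  qed
  ultimately show thesis
    using assms(2) that by (cases s) (auto simp: terminal_def)
qed

theorem theorem3:
  fixes x y :: ov and P :: rterm
  assumes "P \<in> RT0"
    and "simplified P"
    and "\<not> valid TYPE('u) (x, P, y)"
  shows "\<not> (\<exists>run. run 0 = start (x, P, y) \<and> (\<forall>i::nat. proc_step x y (run i) (run (Suc i))))
    \<and> (\<forall>s. (proc_step x y)\<^sup>*\<^sup>* (start (x, P, y)) s \<and> terminal x y s \<longrightarrow>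
          (\<exists>t \<theta> M v. s = Returned t \<theta> M v \<and>
            deduction_tree (x, P, y) t \<and> \<theta> \<in> branches t \<and>
            \<not> axiomatic_branch \<theta> \<and> \<not> expandable \<theta> \<and>
            M = branch_model \<theta> \<and> is_model M \<and>
            is_valuation M v \<and> (\<forall>u\<in>W \<theta>. v u = u) \<and>
            (\<forall>\<phi>\<in>fms \<theta>. \<not> satisfies M v \<phi>) \<and>
            \<not> satisfies M v (x, P, y)))"
proof -
  obtain M :: "'u model" and v where M: "is_model M" and "falsifies M v {(x, P, y)}"
    using assms(3) by (auto simp: valid_def falsifies_def simp del: satisfies.simps)
  then have start: "state_ok x P y M (start (x, P, y))"
    by (simp add: state_ok_start)
  have outer: "outer_term P"
    using RT0_terms[OF assms(1)] by simp
  have "\<exists>t \<theta> N v. s = Returned t \<theta> N v \<and>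
      deduction_tree (x, P, y) t \<and> \<theta> \<in> branches t \<and>
      \<not> axiomatic_branch \<theta> \<and> \<not> expandable \<theta> \<and>
      N = branch_model \<theta> \<and> is_model N \<and>
      is_valuation N v \<and> (\<forall>u\<in>W \<theta>. v u = u) \<and>
      (\<forall>\<phi>\<in>fms \<theta>. \<not> satisfies N v \<phi>) \<and>
      \<not> satisfies N v (x, P, y)"
    if "(proc_step x y)\<^sup>*\<^sup>* (start (x, P, y)) s" "terminal x y s" for s
  proof -
    have ok: "state_ok x P y M s"
      using state_ok_reachable[OF that(1) M start] .
    show ?thesis
      using ok that(2)
    proof (cases rule: terminal_cases)
      \<comment> \<open>A closed tree is impossible: the invariant provides a refuted branch, which
        is not axiomatic.\<close>
      case (1 t)
      then show ?thesis
        using ok falsifies_not_axiomatic_branch by (fastforce simp: state_ok_def)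
    next
      case (2 t \<theta> N v)
      have t: "deduction_tree (x, P, y) t" "proc_branch x P y \<theta>"
        and \<theta>: "\<theta> \<in> branches t" "\<not> axiomatic_branch \<theta>" "\<not> expandable \<theta>" "N = branch_model \<theta>"
          "is_valuation N v" "\<forall>u\<in>W \<theta>. v u = u"
        using ok 2 by (auto simp: state_ok_def)
      interpret saturated_branch x y P \<theta>
        using t(2) outer \<theta>(2,3) by unfold_locales
      have "\<not> satisfies N v \<phi>" if "\<phi> \<in> fms \<theta>" for \<phi>
        using that branch_falsified mem_W \<theta>(4,6) by (cases \<phi>) auto
      then show ?thesis
        using 2 t(1) \<theta> M_model root_mem[OF branch] by blast
    qed
  qed
  moreover have "\<not> (\<exists>run. run 0 = start (x, P, y) \<and>
      (\<forall>i::nat. proc_step x y (run i) (run (Suc i))))"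
    using no_infinite_run[OF outer M] start by metis
  ultimately show ?thesis
    by blast
qed

end
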